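(* Let $a,b,c\in\mathbb{Q}$ with $abc\neq 0$ and $4ac-b^2\neq 0$, and let $\mathcal{E}_1$ be the elliptic curve over $\mathbb{Q}$ \[\mathcal{E}_1:\ Y^2=X^3+27a^2b^2c^2(3ac-b^2)X+27a^3b^4c^3(9ac-2b^2).\] If $b^2\neq kac$ for each $k\in\{-1,1,3\}$, then $\mathcal{E}_1(\mathbb{Q})$ has positive rank. If $b^2=kac$ for some $k\in\{-1,1,3\}$, then $\mathcal{E}_1(\mathbb{Q})$ has rank $0$. *)

theory Defs
  imports "HOL-Algebra.Group" "HOL-Algebra.FiniteProduct" "HOL-Library.Extended_Nat" Complex_Main
begin

section \<open>Short Weierstrass curves and their group of rational points\<close>

text \<open>
  A pair \<open>(A, B)\<close> stands for the projective curve \<open>Y\<^sup>2 = X\<^sup>3 + A X + B\<close> over a field of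
  characteristic other than 2 and 3. It is smooth, i.e. an elliptic curve, exactly when its
  discriminant \<open>-16 (4 A\<^sup>3 + 27 B\<^sup>2)\<close> is nonzero.
\<close>

definition elliptic_curve :: "'a::field_char_0 \<Rightarrow> 'a \<Rightarrow> bool" where
  "elliptic_curve A B \<longleftrightarrow> - 16 * (4 * A ^ 3 + 27 * B ^ 2) \<noteq> 0"

datatype 'a ec_point = Infinity | Affine 'a 'a

fun on_curve :: "'a::field_char_0 \<Rightarrow> 'a \<Rightarrow> 'a ec_point \<Rightarrow> bool" where
  "on_curve A B Infinity \<longleftrightarrow> True"
| "on_curve A B (Affine x y) \<longleftrightarrow> y ^ 2 = x ^ 3 + A * x + B"

text \<open>
  Chord-and-tangent addition. For points of the curve with \<open>x\<^sub>1 = x\<^sub>2\<close> and \<open>y\<^sub>1 \<noteq> - y\<^sub>2\<close>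
  one has \<open>y\<^sub>1 = y\<^sub>2 \<noteq> 0\<close>, so \<open>m\<close> is then the slope of the tangent. The law depends on
  \<open>B\<close> only through the points.
\<close>

fun ec_add :: "'a::field_char_0 \<Rightarrow> 'a ec_point \<Rightarrow> 'a ec_point \<Rightarrow> 'a ec_point" where
  "ec_add A Infinity Q = Q"
| "ec_add A P Infinity = P"
| "ec_add A (Affine x1 y1) (Affine x2 y2) =
     (if x1 = x2 \<and> y1 = - y2 then Infinity
      else let m = (if x1 = x2 then (3 * x1 ^ 2 + A) / (2 * y1) else (y2 - y1) / (x2 - x1));
               x3 = m ^ 2 - x1 - x2
           in Affine x3 (m * (x1 - x3) - y1))"

definition ec_group :: "'a::field_char_0 \<Rightarrow> 'a \<Rightarrow> 'a ec_point monoid" where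
  "ec_group A B = \<lparr>carrier = {P. on_curve A B P}, monoid.mult = ec_add A, one = Infinity\<rparr>"


section \<open>Rank of an abelian group\<close>

text \<open>
  The rank is the supremum of the sizes of finite \<open>\<int>\<close>-linearly independent subsets, that is
  \<open>dim\<^sub>\<rat> (G \<otimes>\<^sub>\<int> \<rat>)\<close>, with value \<open>\<infinity>\<close> if this is infinite. For finitely generated
  \<open>G \<cong> \<int>\<^sup>r \<times> T\<close> with \<open>T\<close> finite it equals \<open>r\<close>. The groups are written multiplicatively.
\<close>

definition int_independent :: "('a, 'm) monoid_scheme \<Rightarrow> 'a set \<Rightarrow> bool" where
  "int_independent G S \<longleftrightarrow>
     (\<forall>n :: 'a \<Rightarrow> int. finprod G (\<lambda>x. x [^]\<^bsub>G\<^esub> n x) S = \<one>\<^bsub>G\<^esub> \<longrightarrow> (\<forall>x\<in>S. n x = 0))"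

definition group_rank :: "('a, 'm) monoid_scheme \<Rightarrow> enat" where
  "group_rank G = (SUP S \<in> {S. finite S \<and> S \<subseteq> carrier G \<and> int_independent G S}. enat (card S))"


section \<open>The curve \<open>\<E>\<^sub>1\<close>\<close>

definition E1_A :: "rat \<Rightarrow> rat \<Rightarrow> rat \<Rightarrow> rat" where
  "E1_A a b c = 27 * a ^ 2 * b ^ 2 * c ^ 2 * (3 * a * c - b ^ 2)"

definition E1_B :: "rat \<Rightarrow> rat \<Rightarrow> rat \<Rightarrow> rat" where
  "E1_B a b c = 27 * a ^ 3 * b ^ 4 * c ^ 3 * (9 * a * c - 2 * b ^ 2)"

lemma elliptic_curve_E1:
  assumes "a * b * c \<noteq> 0" and "4 * a * c - b ^ 2 \<noteq> 0"
  shows "elliptic_curve (E1_A a b c) (E1_B a b c)"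
proof -
  have "4 * E1_A a b c ^ 3 + 27 * E1_B a b c ^ 2
      = 3 ^ 12 * a ^ 8 * b ^ 6 * c ^ 8 * (4 * a * c - b ^ 2)"
    unfolding E1_A_def E1_B_def by algebra
  then show ?thesis
    using assms by (simp add: elliptic_curve_def)
qed

abbreviation E1_points :: "rat \<Rightarrow> rat \<Rightarrow> rat \<Rightarrow> rat ec_point monoid" where
  "E1_points a b c \<equiv> ec_group (E1_A a b c) (E1_B a b c)"

end

theory Submission
  imports Defs "HOL-Library.Set_Algebras" "HOL-Computational_Algebra.Formal_Laurent_Series"
    "HOL-Computational_Algebra.Nth_Powers"
begin

text \<open>
  Put \<open>t = b\<^sup>2 / (a c)\<close>. The curve \<open>\<E>\<^sub>1\<close> is isomorphic to \<open>v\<^sup>2 = u\<^sup>3 - t u\<^sup>2 + t u\<close>, which contains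
  \<open>P = (1, 1)\<close>. With \<open>s = (t - 1) / 2\<close>, the points \<open>2P\<close>, \<open>4P\<close> or \<open>3P\<close> have a \<open>u\<close>-coordinate of large
  2-adic absolute value according as \<open>s\<close> has negative, positive or zero 2-adic valuation, unless
  \<open>s\<close> is 0, 1 or -1, that is \<open>t\<close> is 1, 3 or -1. Repeated doubling of such a point
  increases the absolute value further, so \<open>P\<close> has infinite order. For \<open>t\<close> in \<open>{-1, 1, 3}\<close>, writing
  \<open>u\<close> in lowest terms leads to \<open>z\<^sup>2 = x\<^sup>4 - t x\<^sup>2 y\<^sup>2 + t y\<^sup>4\<close> in coprime positive integers, whose only
  solution with nonzero \<open>x\<close> and \<open>y\<close> is \<open>x = y = 1\<close> by infinite descent, so all points are torsion.

  Associativity of the chord-and-tangent law comes from the Picard group of the affine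
  curve: a point is determined by the class of its maximal ideal, and these classes multiply like
  the points add.
\<close>

section \<open>Associativity of the group law\<close>

text \<open>Doubling on \<open>v^2 = u^3 - t u^2 + t u\<close> sends \<open>u\<close> to
  \<open>((u^2 - t) / (2 v))^2\<close>. At P = (1, 1) this is ((1 - t) / 2)^2 = s^2, which is where
  s comes from. The excluded values are those for which P is torsion: for s = 0 the point 2P is (0,
  0), of order 2, and for s = 1 or s = -1 it is -P. The prime 2 is singled out twice. Near infinity
  v^2 behaves like u^3, so doubling acts on u like division by 4, which 2-adically enlarges it. And
  the residue field has two elements, so for a unit s both s - 1 and s + 1 are even; up to sign
  their product is the denominator of the slope of the line joining 2P to P, and this throws 3P
  towards infinity. Associativity has to come before all this, since powers and independence are
  taken in \<open>ec_group\<close>. Checking it on formulas splits into many cases of chords,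
  tangents and vertical lines. With ideal classes only two relations remain, one for lines
  \<open>y = m x + k\<close> and one for vertical lines. That a point can be recovered from its
  class rests on the absence of regular functions with a simple pole at infinity.\<close>

fun ec_neg :: "'a::field_char_0 ec_point \<Rightarrow> 'a ec_point" where
  "ec_neg Infinity = Infinity"
| "ec_neg (Affine a b) = Affine a (- b)"

lemma on_curve_ec_neg [simp]: "on_curve A B (ec_neg P) \<longleftrightarrow> on_curve A B P"
  by (cases P) auto

lemma ec_neg_ec_neg [simp]: "ec_neg (ec_neg P) = P"
  by (cases P) auto

lemma ec_add_Infinity_right [simp]: "ec_add A P Infinity = P"
  by (cases P) auto

lemma ec_add_eq_Infinity_iff: "ec_add A P Q = Infinity \<longleftrightarrow> Q = ec_neg P"
  by (cases P; cases Q) (auto simp: Let_def)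

lemma ec_add_ec_neg: "ec_add A P (ec_neg P) = Infinity" "ec_add A (ec_neg P) P = Infinity"
  by (simp_all add: ec_add_eq_Infinity_iff)

lemma ec_add_commute:
  assumes "on_curve A B P" "on_curve A B Q"
  shows "ec_add A P Q = ec_add A Q P"
proof (cases P; cases Q)
  fix a b c d assume PQ: "P = Affine a b" "Q = Affine c d"
  show ?thesis
  proof (cases "a = c")
    case True
    then have "b ^ 2 = d ^ 2"
      using assms PQ by simp
    then show ?thesis
      using True PQ by (auto simp: power2_eq_iff Let_def)
  next
    case False
    define m where "m = (d - b) / (c - a)"
    have m: "(b - d) / (a - c) = m"
      unfolding m_def by (metis minus_diff_eq minus_divide_divide)
    have "m * (c - a) = d - b"
      using False by (simp add: m_def)
    then have "m * (a - (m ^ 2 - a - c)) - b = m * (c - (m ^ 2 - c - a)) - d"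
      by algebra
    then show ?thesis
      using False by (simp add: PQ Let_def m m_def [symmetric] algebra_simps)
  qed
qed auto

lemma ec_add_tangent:
  assumes "y \<noteq> 0" "m * (2 * y) = 3 * x ^ 2 + A"
  shows "ec_add A (Affine x y) (Affine x y) = Affine (m ^ 2 - 2 * x) (m * (x - (m ^ 2 - 2 * x)) - y)"
proof -
  have "(3 * x ^ 2 + A) / (2 * y) = m"
    using assms by (simp add: divide_eq_eq)
  then show ?thesis
    using assms(1) by (simp add: Let_def)
qed

lemma ec_add_chord:
  assumes "x1 \<noteq> x2" "m * (x2 - x1) = y2 - y1"
  shows "ec_add A (Affine x1 y1) (Affine x2 y2)
    = Affine (m ^ 2 - x1 - x2) (m * (x1 - (m ^ 2 - x1 - x2)) - y1)"
proof -
  have "(y2 - y1) / (x2 - x1) = m"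
    using assms by (simp add: divide_eq_eq)
  then show ?thesis
    using assms(1) by (simp add: Let_def)
qed

text \<open>
  Vieta's formulas: the line \<open>y = m x + k\<close> meets the curve in points with abscissas \<open>a1\<close>, \<open>a2\<close>,
  \<open>a3\<close>, counted with multiplicity. This treats chords and tangents alike.
\<close>

definition collinear :: "'a::field_char_0 \<Rightarrow> 'a \<Rightarrow> 'a \<Rightarrow> 'a \<Rightarrow> 'a \<Rightarrow> 'a \<Rightarrow> 'a \<Rightarrow> bool" where
  "collinear A B m k a1 a2 a3 \<longleftrightarrow> a1 + a2 + a3 = m ^ 2 \<and>
     a1 * a2 + a1 * a3 + a2 * a3 = A - 2 * m * k \<and> a1 * a2 * a3 = k ^ 2 - B"

lemma ec_add_collinear:
  assumes "on_curve A B (Affine a1 b1)" "on_curve A B (Affine a2 b2)"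
    and ne: "\<not> (a1 = a2 \<and> b1 = - b2)"
  obtains m k a3 where "collinear A B m k a1 a2 a3"
    "b1 = m * a1 + k" "b2 = m * a2 + k"
    "ec_add A (Affine a1 b1) (Affine a2 b2) = Affine a3 (- (m * a3 + k))"
proof -
  define m where "m = (if a1 = a2 then (3 * a1 ^ 2 + A) / (2 * b1) else (b2 - b1) / (a2 - a1))"
  define k where "k = b1 - m * a1"
  define a3 where "a3 = m ^ 2 - a1 - a2"
  have c1: "b1 ^ 2 = a1 ^ 3 + A * a1 + B" and c2: "b2 ^ 2 = a2 ^ 3 + A * a2 + B"
    using assms by auto
  have b1: "b1 = m * a1 + k"
    by (simp add: k_def)
  have sum: "a1 + a2 + a3 = m ^ 2"
    by (simp add: a3_def)
  have "b2 = m * a2 + k \<and> a1 * a2 + a1 * a3 + a2 * a3 = A - 2 * m * k"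
  proof (cases "a1 = a2")
    case True
    then have "b1 ^ 2 = b2 ^ 2"
      using c1 c2 by simp
    then have "b1 = b2" "b1 \<noteq> 0"
      using ne True by (auto simp: power2_eq_iff)
    then have "m * (2 * b1) = 3 * a1 ^ 2 + A"
      by (simp add: m_def True)
    then have "a1 * a1 + a1 * a3 + a1 * a3 = A - 2 * m * k"
      using b1 sum True by algebra
    then show ?thesis
      using True \<open>b1 = b2\<close> b1 by auto
  next
    case False
    then have "m * (a2 - a1) = b2 - b1"
      by (simp add: m_def)
    then have b2: "b2 = m * a2 + k"
      using b1 by algebra
    \<comment> \<open>Subtracting the curve equations at the two points leaves a multiple of
      \<open>a1 - a2\<close>; the cofactor is the second Vieta relation.\<close>
    have "(a1 - a2) * (a1 * a2 + a1 * a3 + a2 * a3 - (A - 2 * m * k)) = 0"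
      using c1 c2 sum unfolding b1 b2 by algebra
    then show ?thesis
      using False b2 by simp
  qed
  note 2 = this
  have "a1 * a2 * a3 = k ^ 2 - B"
    using c1 sum 2 unfolding b1 by algebra
  moreover have "ec_add A (Affine a1 b1) (Affine a2 b2) = Affine a3 (- (m * a3 + k))"
    using ne by (simp add: Let_def m_def [symmetric]) (simp add: k_def a3_def algebra_simps)
  ultimately show ?thesis
    using that b1 2 sum unfolding collinear_def by blast
qed

lemma on_curve_ec_add:
  assumes "on_curve A B P" "on_curve A B Q"
  shows "on_curve A B (ec_add A P Q)"
proof (cases P; cases Q)
  fix a1 b1 a2 b2 assume PQ: "P = Affine a1 b1" "Q = Affine a2 b2"
  show ?thesis
  proof (cases "a1 = a2 \<and> b1 = - b2")
    case False
    obtain m k a3 where *: "collinear A B m k a1 a2 a3"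
      "ec_add A P Q = Affine a3 (- (m * a3 + k))"
      using ec_add_collinear [of A B a1 b1 a2 b2] assms False unfolding PQ by metis
    have "(- (m * a3 + k)) ^ 2 = a3 ^ 3 + A * a3 + B"
      using *(1) unfolding collinear_def by algebra
    then show ?thesis
      using * by simp
  qed (simp add: PQ)
qed (use assms in auto)

section \<open>Regular functions on the affine curve as Laurent series at infinity\<close>

lemma fls_const_hom:
  fixes a b :: "'a::comm_ring_1"
  shows "fls_const (a + b) = fls_const a + fls_const b" "fls_const (a - b) = fls_const a - fls_const b"
    "fls_const (a * b) = fls_const a * fls_const b" "fls_const (- a) = - fls_const a"
    "fls_const (a ^ n) = fls_const a ^ n"
proof -
  show *: "fls_const (a + b) = fls_const a + fls_const b" for a b :: 'a
    by (simp add: fls_plus_const)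
  show m: "fls_const (- a) = - fls_const a" for a :: 'a
    by (rule fls_eqI) simp
  show "fls_const (a - b) = fls_const a - fls_const b"
    using * [of a "- b"] m [of b] by simp
  show "fls_const (a * b) = fls_const a * fls_const b"
    by simp
  show "fls_const (a ^ n) = fls_const a ^ n"
    by (induction n) (simp_all flip: fls_const_mult_const)
qed

lemma fls_const_numeral [simp]: "fls_const (numeral n) = (numeral n :: 'a::comm_ring_1 fls)"
  by (metis fls_const_1 fls_of_nat of_nat_numeral)

text \<open>
  The coordinate ring is realised inside a field of Laurent series: \<open>x\<close> and \<open>y\<close> are the expansions of
  the coordinate functions at the point at infinity, so that \<open>fls_subdegree\<close> is the order there.
\<close>

locale function_field =
  fixes A B :: "'a::field_char_0" and x y :: "'a fls"
  assumes weierstrass: "y ^ 2 = x ^ 3 + fls_const A * x + fls_const B"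
    and subdegree_x: "fls_subdegree x = - 2" and subdegree_y: "fls_subdegree y = - 3"
begin

lemma x_nonzero: "x \<noteq> 0" and y_nonzero: "y \<noteq> 0"
  using subdegree_x subdegree_y by auto

inductive_set polys :: "'a fls set" where
  const: "fls_const c \<in> polys"
| step: "p \<in> polys \<Longrightarrow> fls_const c + x * p \<in> polys"

lemma polys_add: "p \<in> polys \<Longrightarrow> q \<in> polys \<Longrightarrow> p + q \<in> polys"
proof (induction arbitrary: q rule: polys.induct)
  case (const c)
  from const show ?case
  proof (cases rule: polys.cases)
    case (step p d)
    then show ?thesis
      using polys.step [of p "c + d"] by (simp add: fls_const_hom algebra_simps del: fls_const_mult_const)
  qed (simp add: fls_plus_const polys.const)
next
  case (step p c)
  from step.prems show ?case
  proof (cases rule: polys.cases)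
    case (const d)
    then show ?thesis
      using polys.step [OF step.hyps, of "c + d"] by (simp add: fls_const_hom algebra_simps del: fls_const_mult_const)
  next
    case (step p' d)
    then show ?thesis
      using polys.step [OF step.IH [OF step(2)], of "c + d"]
      by (simp add: fls_const_hom algebra_simps del: fls_const_mult_const)
  qed
qed

lemma polys_x: "p \<in> polys \<Longrightarrow> x * p \<in> polys"
  using polys.step [of p 0] by simp

lemma polys_mult: "p \<in> polys \<Longrightarrow> q \<in> polys \<Longrightarrow> p * q \<in> polys"
proof (induction rule: polys.induct)
  case (const c)
  then show ?case
  proof (induction rule: polys.induct)
    case (step p d)
    then show ?case
      using polys.step [of "fls_const c * p" "c * d"] by (simp add: fls_const_hom algebra_simps del: fls_const_mult_const)
  qed (simp add: polys.const)
next
  case (step p c)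
  have "fls_const c * q \<in> polys"
    using step.prems
  proof (induction rule: polys.induct)
    case (step p d)
    then show ?case
      using polys.step [of "fls_const c * p" "c * d"] by (simp add: fls_const_hom algebra_simps del: fls_const_mult_const)
  qed (simp add: polys.const)
  then have "fls_const c * q + x * (p * q) \<in> polys"
    using step by (intro polys_add polys_x)
  then show ?case
    by (simp add: algebra_simps)
qed

text \<open>Each Horner step multiplies by \<open>x\<close>, which has a double pole, and the added
  constant cannot cancel that pole. Pole orders therefore stay even.\<close>

lemma polys_subdegree:
  assumes "p \<in> polys"
  shows "p = 0 \<or> (\<exists>c. c \<noteq> 0 \<and> p = fls_const c) \<or> even (fls_subdegree p) \<and> fls_subdegree p \<le> - 2"
  using assms
proof (induction rule: polys.induct)
  case (const c)
  then show ?case by auto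
next
  case (step p c)
  show ?case
  proof (cases "p = 0")
    case False
    have p: "even (fls_subdegree p) \<and> fls_subdegree p \<le> 0"
      using step.IH False by auto
    have "fls_subdegree (x * p) = fls_subdegree p - 2" "x * p \<noteq> 0"
      using False x_nonzero by (simp_all add: subdegree_x)
    moreover from this have "fls_subdegree (fls_const c + x * p) = fls_subdegree (x * p)"
      using p by (intro fls_subdegree_add_eq2) auto
    ultimately show ?thesis
      using p by auto
  qed auto
qed

definition coord_ring :: "'a fls set" where
  "coord_ring = {p + q * y | p q. p \<in> polys \<and> q \<in> polys}"

lemma coord_ringI: "p \<in> polys \<Longrightarrow> q \<in> polys \<Longrightarrow> p + q * y \<in> coord_ring"
  by (auto simp: coord_ring_def)

lemma coord_ring_const [simp]: "fls_const c \<in> coord_ring"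
  using coord_ringI [OF polys.const [of c] polys.const [of 0]] by simp

lemma coord_ring_numeral [simp]: "1 \<in> coord_ring" "0 \<in> coord_ring" "numeral n \<in> coord_ring"
  using coord_ring_const [of 1] coord_ring_const [of 0] coord_ring_const [of "numeral n"] by simp_all

lemma coord_ring_x [simp]: "x \<in> coord_ring"
  using coord_ringI [OF polys_x [OF polys.const [of 1]] polys.const [of 0]] by simp

lemma coord_ring_y [simp]: "y \<in> coord_ring"
  using coord_ringI [OF polys.const [of 0] polys.const [of 1]] by simp

lemma coord_ring_add [simp]:
  assumes "r \<in> coord_ring" "s \<in> coord_ring" shows "r + s \<in> coord_ring"
proof -
  obtain p q p' q' where *: "r = p + q * y" "s = p' + q' * y"
    "p \<in> polys" "q \<in> polys" "p' \<in> polys" "q' \<in> polys"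
    using assms by (auto simp: coord_ring_def)
  show ?thesis
    using coord_ringI [of "p + p'" "q + q'"] * by (simp add: polys_add algebra_simps)
qed

lemma coord_ring_mult [simp]:
  assumes "r \<in> coord_ring" "s \<in> coord_ring" shows "r * s \<in> coord_ring"
proof -
  obtain p q p' q' where *: "r = p + q * y" "s = p' + q' * y"
    "p \<in> polys" "q \<in> polys" "p' \<in> polys" "q' \<in> polys"
    using assms by (auto simp: coord_ring_def)
  define f where "f = fls_const B + x * (fls_const A + x * (fls_const 0 + x * fls_const 1))"
  have "f \<in> polys"
    unfolding f_def by (intro polys.intros)
  moreover have f: "y * y = f"
    using weierstrass by (simp add: f_def power2_eq_square power3_eq_cube algebra_simps)
  have "r * s = (p * p' + q * q' * f) + (p * q' + q * p') * y"
    unfolding * f [symmetric] by algebra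
  ultimately show ?thesis
    using coord_ringI [of "p * p' + q * q' * f" "p * q' + q * p'"] *
    by (simp add: polys_add polys_mult)
qed

lemma coord_ring_minus [simp]: "r \<in> coord_ring \<Longrightarrow> - r \<in> coord_ring"
  using coord_ring_mult [OF coord_ring_const [of "- 1"]] by (simp add: fls_const_hom del: fls_const_mult_const)

lemma coord_ring_diff [simp]: "r \<in> coord_ring \<Longrightarrow> s \<in> coord_ring \<Longrightarrow> r - s \<in> coord_ring"
  using coord_ring_add [of r "- s"] by simp

lemma coord_ring_power [simp]: "r \<in> coord_ring \<Longrightarrow> r ^ n \<in> coord_ring"
  by (induction n) simp_all

text \<open>A regular function has no simple pole at infinity, since the curve has positive genus.\<close>

lemma coord_ring_subdegree:
  assumes "r \<in> coord_ring"
  shows "r = 0 \<or> (\<exists>c. c \<noteq> 0 \<and> r = fls_const c) \<or> fls_subdegree r \<le> - 2"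
proof -
  obtain p q where r: "r = p + q * y" and "p \<in> polys" "q \<in> polys"
    using assms by (auto simp: coord_ring_def)
  note pq = polys_subdegree [OF \<open>p \<in> polys\<close>] polys_subdegree [OF \<open>q \<in> polys\<close>]
  consider "q = 0" | "p = 0" "q \<noteq> 0" | "p \<noteq> 0" "q \<noteq> 0"
    by blast
  then show ?thesis
  proof cases
    case 1
    then show ?thesis using pq r by auto
  next
    case 2
    then show ?thesis using pq r y_nonzero by (auto simp: subdegree_y)
  next
    case 3
    have q: "even (fls_subdegree q)" "fls_subdegree q \<le> 0"
      using pq(2) 3 by auto
    have p: "even (fls_subdegree p)"
      using pq(1) 3 by auto
    have qy: "fls_subdegree (q * y) = fls_subdegree q - 3" "q * y \<noteq> 0"
      using 3 y_nonzero by (simp_all add: subdegree_y)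
    \<comment> \<open>The order of \<open>p\<close> is even and that of \<open>q * y\<close> is odd,
      so leading terms never cancel, and \<open>q * y\<close> alone contributes a pole of order at
      least 3.\<close>
    then have "fls_subdegree p \<noteq> fls_subdegree (q * y)"
      using p q by presburger
    then have "fls_subdegree r = min (fls_subdegree p) (fls_subdegree (q * y))"
      using fls_subdegree_add_eq1 [OF 3(1), of "q * y"] fls_subdegree_add_eq2 [OF qy(2), of p] r
      by (auto simp: min_def)
    then show ?thesis
      using qy q by auto
  qed
qed

section \<open>Fractional ideals, given by generators, and their classes\<close>

inductive_set rspan :: "'a fls set \<Rightarrow> 'a fls set" for S where
  zero: "0 \<in> rspan S"
| step: "r \<in> coord_ring \<Longrightarrow> s \<in> S \<Longrightarrow> z \<in> rspan S \<Longrightarrow> r * s + z \<in> rspan S"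

lemma rspan_add: "u \<in> rspan S \<Longrightarrow> v \<in> rspan S \<Longrightarrow> u + v \<in> rspan S"
  by (induction rule: rspan.induct) (auto simp: add.assoc intro: rspan.step)

lemma rspan_mult: "u \<in> rspan S \<Longrightarrow> r \<in> coord_ring \<Longrightarrow> r * u \<in> rspan S"
proof (induction rule: rspan.induct)
  case (step r' s z)
  then show ?case
    using rspan.step [of "r * r'" s S "r * z"] by (simp add: algebra_simps)
qed (simp add: rspan.zero)

lemma rspan_base: "s \<in> S \<Longrightarrow> s \<in> rspan S"
  using rspan.step [of 1 s S 0] rspan.zero by simp

lemma rspan_least: "S \<subseteq> rspan T \<Longrightarrow> rspan S \<subseteq> rspan T"
proof
  fix u assume "S \<subseteq> rspan T" "u \<in> rspan S"
  from this(2,1) show "u \<in> rspan T"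
    by (induction rule: rspan.induct) (auto intro: rspan.zero rspan_add rspan_mult)
qed

lemma rspan_times:
  assumes "u \<in> rspan S" "v \<in> rspan T" shows "u * v \<in> rspan (S * T)"
  using assms(1)
proof (induction rule: rspan.induct)
  case (step r s z)
  have "s * v \<in> rspan (S * T)"
    using assms(2)
  proof (induction rule: rspan.induct)
    case (step r' t w)
    then show ?case
      using rspan.step [of r' "s * t" "S * T" "s * w"] \<open>s \<in> S\<close>
      by (simp add: set_times_intro algebra_simps)
  qed (simp add: rspan.zero)
  then have "r * (s * v) + z * v \<in> rspan (S * T)"
    using step by (simp add: rspan_add rspan_mult)
  then show ?case
    by (simp only: distrib_right mult.assoc)
qed (simp add: rspan.zero)

lemma rspan_times_mono: "rspan S \<subseteq> rspan S' \<Longrightarrow> rspan (S * T) \<subseteq> rspan (S' * T)"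
proof (rule rspan_least, rule subsetI)
  fix u assume "rspan S \<subseteq> rspan S'" "u \<in> S * T"
  then obtain s t where "u = s * t" "s \<in> rspan S'" "t \<in> rspan T"
    by (meson set_times_elim rspan_base subsetD)
  then show "u \<in> rspan (S' * T)"
    by (simp add: rspan_times)
qed

lemma rspan_times_cong: "rspan S = rspan S' \<Longrightarrow> rspan (S * T) = rspan (S' * T)"
  by (simp add: equalityI rspan_times_mono)

lemma rspan_singleton: "rspan {c} = {r * c | r. r \<in> coord_ring}"
proof (intro subset_antisym subsetI)
  fix u assume "u \<in> rspan {c}"
  then show "u \<in> {r * c | r. r \<in> coord_ring}"
  proof (induction rule: rspan.induct)
    case zero
    then show ?case by (force intro: exI [of _ 0])
  next
    case (step r s z)
    then obtain r' where "r' \<in> coord_ring" "z = r' * c" by auto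
    then show ?case
      using step by (auto intro!: exI [of _ "r + r'"] simp: algebra_simps)
  qed
qed (auto intro: rspan_mult rspan_base)

text \<open>Equality of ideal classes. Sets of generators stand for ideals, so multiplication of
  classes is the elementwise product of sets. The scalar \<open>c\<close> ranges over all nonzero
  Laurent series, a field that contains the function field.\<close>

definition equivalent :: "'a fls set \<Rightarrow> 'a fls set \<Rightarrow> bool" (infix \<open>\<approx>\<close> 50) where
  "S \<approx> T \<longleftrightarrow> (\<exists>c. c \<noteq> 0 \<and> rspan S = rspan ({c} * T))"

lemma singleton_one_times [simp]: "{1::'a fls} * S = S"
  by (auto elim!: set_times_elim simp: set_times_def)

lemma singleton_times_singleton [simp]: "{c::'a fls} * {d} = {c * d}"
  by (auto simp: set_times_def)

lemma equivalent_refl [simp]: "S \<approx> S"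
  unfolding equivalent_def by (rule exI [of _ 1]) simp

lemma equivalent_sym: assumes "S \<approx> T" shows "T \<approx> S"
proof -
  obtain c where c: "c \<noteq> 0" "rspan S = rspan ({c} * T)"
    using assms by (auto simp: equivalent_def)
  have "rspan (S * {inverse c}) = rspan ({c} * T * {inverse c})"
    using c(2) by (rule rspan_times_cong)
  also have "{c} * T * {inverse c} = ({c} * {inverse c}) * T"
    by (simp only: mult_ac)
  also have "\<dots> = T"
    using c by simp
  finally show ?thesis
    using c unfolding equivalent_def by (intro exI [of _ "inverse c"]) (simp add: mult.commute)
qed

lemma equivalent_times:
  assumes "S \<approx> S'" shows "S * T \<approx> S' * T"
  using assms rspan_times_cong unfolding equivalent_def by (metis mult.assoc)

lemma equivalent_trans [trans]:
  assumes "S \<approx> T" "T \<approx> U" shows "S \<approx> U"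
proof -
  obtain c where c: "c \<noteq> 0" "rspan S = rspan ({c} * T)"
    using assms by (auto simp: equivalent_def)
  obtain d where d: "d \<noteq> 0" "rspan T = rspan ({d} * U)"
    using assms by (auto simp: equivalent_def)
  have "rspan (T * {c}) = rspan ({d} * U * {c})"
    using d(2) by (rule rspan_times_cong)
  also have "{d} * U * {c} = ({c} * {d}) * U"
    by (simp only: mult_ac)
  finally show ?thesis
    using c d unfolding equivalent_def by (intro exI [of _ "c * d"]) (simp add: mult.commute)
qed

lemma equivalent_times2: "S \<approx> S' \<Longrightarrow> T \<approx> T' \<Longrightarrow> S * T \<approx> S' * T'"
  using equivalent_times [of S S' T] equivalent_times [of T T' S']
  by (metis equivalent_trans mult.commute)

text \<open>Generators of the maximal ideal of a point, representing its class in the Picard group.\<close>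

fun point_ideal :: "'a ec_point \<Rightarrow> 'a fls set" where
  "point_ideal Infinity = {1}"
| "point_ideal (Affine a b) = {x - fls_const a, y - fls_const b}"

lemma point_ideal_subset: "point_ideal P \<subseteq> coord_ring"
  by (cases P) auto

lemma rspan_multiple: "r \<in> coord_ring \<Longrightarrow> r * c \<in> rspan {c}"
  by (auto simp: rspan_singleton)

lemma rspan_mem_diff: "u \<in> rspan S \<Longrightarrow> v \<in> rspan S \<Longrightarrow> u - v \<in> rspan S"
  using rspan_add [of u S "- v"] rspan_mult [of v S "- 1"] by simp

text \<open>The vertical line through a point meets the curve in that point and its negative.
  Products of generators are multiples of \<open>x - a\<close> because y^2 - b^2 is. The converse
  needs \<open>x - a\<close> itself as a combination of these products, and for \<open>b = 0\<close>
  this is where smoothness enters.\<close>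

lemma point_ideal_neg_times:
  assumes "on_curve A B (Affine a b)" "elliptic_curve A B"
  shows "rspan (point_ideal (Affine a b) * point_ideal (Affine a (- b))) = rspan {x - fls_const a}"
    (is "rspan ?S = _")
proof
  let ?a = "fls_const a" and ?b = "fls_const b"
  define g where "g = x ^ 2 + ?a * x + ?a ^ 2 + fls_const A"
  have c: "b ^ 2 = a ^ 3 + A * a + B"
    using assms by simp
  then have cf: "?b ^ 2 = ?a ^ 3 + fls_const A * ?a + fls_const B"
    by (metis fls_const_hom)
  have yy: "(y - ?b) * (y + ?b) = g * (x - ?a)"
    using weierstrass cf unfolding g_def by algebra
  have mb: "fls_const (- b) = - ?b"
    by (simp add: fls_const_hom del: fls_const_mult_const)
  have "u * v \<in> rspan {x - ?a}" if "u \<in> {x - ?a, y - ?b}" "v \<in> {x - ?a, y + ?b}" for u v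
  proof -
    have "g \<in> coord_ring" by (simp add: g_def)
    then have "(y - ?b) * (y + ?b) \<in> rspan {x - ?a}"
      unfolding yy by (rule rspan_multiple)
    moreover have "(x - ?a) * v \<in> rspan {x - ?a}"
      using that rspan_multiple [of v "x - ?a"] by (auto simp: mult.commute)
    moreover have "u * (x - ?a) \<in> rspan {x - ?a}"
      using that by (intro rspan_multiple) auto
    ultimately show ?thesis
      using that by auto
  qed
  then show "rspan ?S \<subseteq> rspan {x - ?a}"
    by (intro rspan_least) (auto elim!: set_times_elim simp: mb)
  have mem: "u * v \<in> rspan ?S" if "u \<in> {x - ?a, y - ?b}" "v \<in> {x - ?a, y + ?b}" for u v
    using that by (intro rspan_base set_times_intro) (auto simp: mb)
  have "x - ?a \<in> rspan ?S"
  proof (cases "b = 0")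
    case False
    define h where "h = fls_const (inverse (2 * b))"
    have "fls_const (inverse (2 * b) * (2 * b)) = 1"
      using False by simp
    then have "h * (2 * ?b) = 1"
      unfolding h_def by (simp only: fls_const_hom fls_const_numeral)
    then have "x - ?a = h * ((x - ?a) * (y + ?b) - (y - ?b) * (x - ?a))"
      by algebra
    also have "\<dots> \<in> rspan ?S"
      by (intro rspan_mult rspan_mem_diff mem) (auto simp: h_def)
    finally show ?thesis .
  next
    case True
    \<comment> \<open>For \<open>b = 0\<close> the abscissa \<open>a\<close> is a root of the cubic;
      a vanishing derivative would make it a double root.\<close>
    have "3 * a ^ 2 + A \<noteq> 0"
    proof
      assume "3 * a ^ 2 + A = 0"
      then have "4 * A ^ 3 + 27 * B ^ 2 = 0"
        using c True by algebra
      then show False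
        using assms(2) by (simp add: elliptic_curve_def)
    qed
    define h where "h = fls_const (inverse (3 * a ^ 2 + A))"
    have "fls_const (inverse (3 * a ^ 2 + A) * (3 * a ^ 2 + A)) = 1"
      using \<open>3 * a ^ 2 + A \<noteq> 0\<close> by simp
    then have "h * (3 * ?a ^ 2 + fls_const A) = 1"
      unfolding h_def by (simp only: fls_const_hom fls_const_numeral)
    \<comment> \<open>Taylor expansion of \<open>g\<close> at \<open>a\<close>: it equals 3 a^2 + A
      + (x - a) (x + 2 a), so (y - b) (y + b) is a nonzero constant times x - a, up to a multiple of
      (x - a)^2.\<close>
    then have "x - ?a = h * ((y - ?b) * (y + ?b) - (x + 2 * ?a) * ((x - ?a) * (x - ?a)))"
      unfolding yy g_def by algebra
    also have "\<dots> \<in> rspan ?S"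
      by (intro rspan_mult rspan_mem_diff mem) (auto simp: h_def)
    finally show ?thesis .
  qed
  then show "rspan {x - ?a} \<subseteq> rspan ?S"
    by (intro rspan_least) auto
qed

lemma x_minus_const:
  "x - fls_const a \<noteq> 0" "fls_subdegree (x - fls_const a) = - 2"
proof -
  show *: "fls_subdegree (x - fls_const a) = - 2"
    using fls_subdegree_diff_eq1 [OF x_nonzero, of "fls_const a"] by (simp add: subdegree_x)
  show "x - fls_const a \<noteq> 0"
    using * by auto
qed

lemma y_minus_const:
  "y - fls_const a \<noteq> 0" "fls_subdegree (y - fls_const a) = - 3"
proof -
  show *: "fls_subdegree (y - fls_const a) = - 3"
    using fls_subdegree_diff_eq1 [OF y_nonzero, of "fls_const a"] by (simp add: subdegree_y)
  show "y - fls_const a \<noteq> 0"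
    using * by auto
qed

lemma point_ideal_neg:
  assumes "on_curve A B P" "elliptic_curve A B"
  shows "point_ideal P * point_ideal (ec_neg P) \<approx> {1}"
proof (cases P)
  case (Affine a b)
  then show ?thesis
    using point_ideal_neg_times [of a b] assms x_minus_const(1) [of a]
    unfolding equivalent_def by (intro exI [of _ "x - fls_const a"]) auto
qed simp

lemma point_ideal_line_subset:
  assumes "collinear A B m k a1 a2 a3"
  shows "point_ideal (Affine a1 (m * a1 + k)) * point_ideal (Affine a2 (m * a2 + k))
      * point_ideal (Affine a3 (m * a3 + k)) \<subseteq> rspan {y - (fls_const m * x + fls_const k)}"
    and "(x - fls_const a1) * (x - fls_const a2) * (x - fls_const a3)
      = (y - (fls_const m * x + fls_const k)) * (y + (fls_const m * x + fls_const k))"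
proof -
  define l l' where "l = y - (fls_const m * x + fls_const k)"
    and "l' = y + (fls_const m * x + fls_const k)"
  have "fls_const a1 + fls_const a2 + fls_const a3 = fls_const m ^ 2"
    "fls_const a1 * fls_const a2 + fls_const a1 * fls_const a3 + fls_const a2 * fls_const a3
      = fls_const A - 2 * fls_const m * fls_const k"
    "fls_const a1 * fls_const a2 * fls_const a3 = fls_const k ^ 2 - fls_const B"
    using assms unfolding collinear_def
    by (metis fls_const_hom fls_const_numeral)+
  then show *: "(x - fls_const a1) * (x - fls_const a2) * (x - fls_const a3)
      = (y - (fls_const m * x + fls_const k)) * (y + (fls_const m * x + fls_const k))"
    using weierstrass by algebra
  \<comment> \<open>Modulo \<open>l\<close> the second generator y - (m a + k) becomes m (x - a). So
    each factor is a multiple of x - a modulo \<open>l\<close>, and the product of the three linear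
    terms is \<open>l * l'\<close>.\<close>
  have gen: "\<exists>\<epsilon> \<mu>. \<epsilon> \<in> coord_ring \<and> \<mu> \<in> coord_ring \<and> e = \<epsilon> * l + \<mu> * (x - fls_const a)"
    if "e \<in> point_ideal (Affine a (m * a + k))" for e a
  proof -
    from that consider "e = x - fls_const a" | "e = y - fls_const (m * a + k)"
      by auto
    then show ?thesis
    proof cases
      case 1
      then show ?thesis
        by (intro exI [of _ 0] exI [of _ 1]) simp
    next
      case 2
      then have "e = 1 * l + fls_const m * (x - fls_const a)"
        unfolding fls_const_hom l_def by algebra
      then show ?thesis
        using coord_ring_const coord_ring_numeral(1) by blast
    qed
  qed
  have lR: "l \<in> coord_ring" "l' \<in> coord_ring"
    by (simp_all add: l_def l'_def)
  show "point_ideal (Affine a1 (m * a1 + k)) * point_ideal (Affine a2 (m * a2 + k))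
      * point_ideal (Affine a3 (m * a3 + k)) \<subseteq> rspan {y - (fls_const m * x + fls_const k)}"
    (is "?G1 * ?G2 * ?G3 \<subseteq> _")
  proof
    fix u assume "u \<in> ?G1 * ?G2 * ?G3"
    then obtain e1 e2 e3 where u: "u = e1 * e2 * e3" "e1 \<in> ?G1" "e2 \<in> ?G2" "e3 \<in> ?G3"
      unfolding set_times_def by blast
    obtain \<epsilon>1 \<mu>1 where 1: "\<epsilon>1 \<in> coord_ring" "\<mu>1 \<in> coord_ring" "e1 = \<epsilon>1 * l + \<mu>1 * (x - fls_const a1)"
      using gen [OF u(2)] by blast
    obtain \<epsilon>2 \<mu>2 where 2: "\<epsilon>2 \<in> coord_ring" "\<mu>2 \<in> coord_ring" "e2 = \<epsilon>2 * l + \<mu>2 * (x - fls_const a2)"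
      using gen [OF u(3)] by blast
    obtain \<epsilon>3 \<mu>3 where 3: "\<epsilon>3 \<in> coord_ring" "\<mu>3 \<in> coord_ring" "e3 = \<epsilon>3 * l + \<mu>3 * (x - fls_const a3)"
      using gen [OF u(4)] by blast
    have "u = (\<epsilon>1 * e2 * e3 + \<mu>1 * (x - fls_const a1) * \<epsilon>2 * e3
      + \<mu>1 * (x - fls_const a1) * \<mu>2 * (x - fls_const a2) * \<epsilon>3 + \<mu>1 * \<mu>2 * \<mu>3 * l') * l"
      using * unfolding u(1) 1 2 3 l_def [symmetric] l'_def [symmetric] by algebra
    moreover have "e2 \<in> coord_ring" "e3 \<in> coord_ring"
      using 2 3 lR by simp_all
    ultimately have "u \<in> rspan {l}"
      using 1 2 3 lR by (simp only:) (intro rspan_multiple, simp)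
    then show "u \<in> rspan {y - (fls_const m * x + fls_const k)}"
      by (simp add: l_def)
  qed
qed

text \<open>
  Only one inclusion in (product of the three point ideals) = (line) is verified on generators. The
  other one follows since multiplying by the conjugate ideals gives equality of norms.
\<close>

lemma point_ideal_line:
  assumes E: "elliptic_curve A B" and col: "collinear A B m k a1 a2 a3"
    and on: "\<And>a. a \<in> {a1, a2, a3} \<Longrightarrow> on_curve A B (Affine a (m * a + k))"
  shows "point_ideal (Affine a1 (m * a1 + k)) * point_ideal (Affine a2 (m * a2 + k))
      * point_ideal (Affine a3 (m * a3 + k)) \<approx> {1}"
    (is "?G1 * ?G2 * ?G3 \<approx> _")
proof -
  define l l' where "l = y - (fls_const m * x + fls_const k)"
    and "l' = y + (fls_const m * x + fls_const k)"
  define d where "d a = x - fls_const a" for a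
  have ll': "d a1 * d a2 * d a3 = l * l'"
    unfolding d_def l_def l'_def by (rule point_ideal_line_subset(2) [OF col])
  have "d a \<noteq> 0" for a
    unfolding d_def by (rule x_minus_const(1))
  then have "l * l' \<noteq> 0"
    unfolding ll' [symmetric] by simp
  then have nz: "l \<noteq> 0" "l' \<noteq> 0"
    by auto
  define J J' where "J = ?G1 * ?G2 * ?G3" and "J' = point_ideal (Affine a1 (- (m * a1 + k)))
      * point_ideal (Affine a2 (- (m * a2 + k))) * point_ideal (Affine a3 (- (m * a3 + k)))"
  have J: "J \<subseteq> rspan {l}"
    unfolding J_def l_def by (rule point_ideal_line_subset(1) [OF col])
  have "collinear A B (- m) (- k) a1 a2 a3"
    using col by (simp add: collinear_def)
  moreover have "y - (fls_const (- m) * x + fls_const (- k)) = l'" "- m * a + - k = - (m * a + k)" for a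
    unfolding l'_def fls_const_hom(4) by algebra+
  ultimately have J': "J' \<subseteq> rspan {l'}"
    unfolding J'_def using point_ideal_line_subset(1) by metis
  have N: "rspan (point_ideal (Affine a (m * a + k)) * point_ideal (Affine a (- (m * a + k))))
      = rspan {d a}" if "a \<in> {a1, a2, a3}" for a
    unfolding d_def by (rule point_ideal_neg_times [OF on [OF that] E])
  have times2: "rspan (S * T) = rspan (S' * T')" if "rspan S = rspan S'" "rspan T = rspan T'" for S T S' T'
    using that by (metis rspan_times_cong mult.commute)
  have "J * J' = (?G1 * point_ideal (Affine a1 (- (m * a1 + k))))
      * (?G2 * point_ideal (Affine a2 (- (m * a2 + k))))
      * (?G3 * point_ideal (Affine a3 (- (m * a3 + k))))"
    unfolding J_def J'_def by (simp only: mult_ac)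
  also have "rspan \<dots> = rspan ({d a1} * {d a2} * {d a3})"
    by (intro times2 N) auto
  finally have JJ': "rspan (J * J') = rspan {l * l'}"
    by (simp add: ll')
  \<comment> \<open>Division by \<open>l'\<close> is possible because \<open>J'\<close> lies in
    \<open>rspan {l'}\<close>: its elements divided by \<open>l'\<close> are regular. Hence
    \<open>J * J' * {inverse l'}\<close>, which generates the ideal of \<open>l\<close>, stays
    inside \<open>rspan J\<close>.\<close>
  have "l \<in> rspan J"
  proof -
    have "rspan (J * J' * {inverse l'}) = rspan ({l * l'} * {inverse l'})"
      using JJ' by (rule rspan_times_cong)
    also have "{l * l'} * {inverse l'} = {l}"
      using nz by (simp add: mult.assoc)
    finally have "l \<in> rspan (J * J' * {inverse l'})"
      using rspan_base [of l "{l}"] by simp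
    moreover have "J * J' * {inverse l'} \<subseteq> rspan J"
    proof
      fix u assume "u \<in> J * J' * {inverse l'}"
      then obtain v w where u: "u = v * w * inverse l'" "v \<in> J" "w \<in> J'"
        by (auto elim!: set_times_elim)
      obtain r where "r \<in> coord_ring" "w = r * l'"
        using J' u(3) by (auto simp: rspan_singleton)
      then have "u = r * v"
        using u nz by simp
      then show "u \<in> rspan J"
        using \<open>r \<in> coord_ring\<close> u(2) by (simp add: rspan_mult rspan_base)
    qed
    ultimately show ?thesis
      using rspan_least by blast
  qed
  then have "rspan J = rspan {l}"
    using J rspan_least by (intro subset_antisym) auto
  then show ?thesis
    using nz unfolding J_def equivalent_def by (intro exI [of _ l]) simp
qed

text \<open>P, Q and the negative of their sum S lie on a line, so their classes have trivial
  product. Multiplying by the class of S cancels that of its negative.\<close>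

lemma point_ideal_add:
  assumes E: "elliptic_curve A B" and P: "on_curve A B P" and Q: "on_curve A B Q"
  shows "point_ideal (ec_add A P Q) \<approx> point_ideal P * point_ideal Q"
proof (cases "P = Infinity \<or> Q = Infinity")
  case False
  then obtain a1 b1 a2 b2 where PQ: "P = Affine a1 b1" "Q = Affine a2 b2"
    by (metis ec_point.exhaust)
  show ?thesis
  proof (cases "a1 = a2 \<and> b1 = - b2")
    case True
    then show ?thesis
      using point_ideal_neg [OF P E] by (simp add: PQ equivalent_sym)
  next
    case False
    obtain m k a3 where *: "collinear A B m k a1 a2 a3" "b1 = m * a1 + k" "b2 = m * a2 + k"
      "ec_add A P Q = Affine a3 (- (m * a3 + k))"
      using ec_add_collinear [of A B a1 b1 a2 b2] P Q False unfolding PQ by metis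
    define S where "S = ec_add A P Q"
    have S: "on_curve A B S"
      unfolding S_def using P Q by (rule on_curve_ec_add)
    have nS: "ec_neg S = Affine a3 (m * a3 + k)"
      by (simp add: S_def *)
    have "on_curve A B (ec_neg S)"
      using S by simp
    then have "point_ideal P * point_ideal Q * point_ideal (ec_neg S) \<approx> {1}"
      unfolding PQ nS *(2,3) using P Q *
      by (intro point_ideal_line E) (auto simp: PQ)
    from equivalent_times [OF this, of "point_ideal S"]
    have 1: "point_ideal P * point_ideal Q * (point_ideal S * point_ideal (ec_neg S)) \<approx> point_ideal S"
      by (simp add: mult_ac)
    have "point_ideal P * point_ideal Q * (point_ideal S * point_ideal (ec_neg S))
        \<approx> point_ideal P * point_ideal Q * {1}"
      by (intro equivalent_times2 equivalent_refl point_ideal_neg S E)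
    with 1 have "point_ideal S \<approx> point_ideal P * point_ideal Q * {1}"
      by (rule equivalent_trans [OF equivalent_sym])
    then show ?thesis
      by (simp only: S_def mult.commute [of _ "{1}"] singleton_one_times)
  qed
qed (use singleton_one_times in \<open>auto simp: mult.commute\<close>)

text \<open>The generator divides functions whose poles at infinity have orders 2 and 3. If
  \<open>c\<close> had a pole of order 2, the cofactor of y - b would have a simple pole; if of
  order 3 or more, the cofactor of x - a would vanish at infinity. Neither happens for a nonzero
  regular function, so \<open>c\<close> is constant.\<close>

lemma point_ideal_principal_aux:
  assumes "rspan (point_ideal (Affine a b)) = rspan {c}" "c \<noteq> 0"
  shows "\<exists>d. d \<noteq> 0 \<and> c = fls_const d"
proof -
  have "c \<in> coord_ring"
    using rspan_least [of "point_ideal (Affine a b)" "{1}"] point_ideal_subset [of "Affine a b"]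
      assms(1) rspan_base [of c "{c}"] by (auto simp: rspan_singleton)
  have "x - fls_const a \<in> rspan {c}" "y - fls_const b \<in> rspan {c}"
    using assms(1) rspan_base [of _ "point_ideal (Affine a b)"] by auto
  then obtain r s where rs: "r \<in> coord_ring" "x - fls_const a = r * c"
    "s \<in> coord_ring" "y - fls_const b = s * c"
    by (auto simp: rspan_singleton)
  have nz: "r \<noteq> 0" "s \<noteq> 0"
    using rs x_minus_const(1) [of a] y_minus_const(1) [of b] by auto
  have "fls_subdegree r + fls_subdegree c = - 2" "fls_subdegree s + fls_subdegree c = - 3"
    using nz assms(2) x_minus_const(2) [of a] y_minus_const(2) [of b] unfolding rs by simp_all
  then have "fls_subdegree c > -2"
    using coord_ring_subdegree [OF rs(1)] coord_ring_subdegree [OF rs(3)] nz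
    by (elim disjE exE conjE) auto
  then show ?thesis
    using coord_ring_subdegree [OF \<open>c \<in> coord_ring\<close>] assms(2) by auto
qed

text \<open>A generator of the ideal of an affine point would be constant, making the ideal the
  whole ring. The ideal of the negative point would then be generated by \<open>x - a\<close>, which
  would have to be constant as well.\<close>

lemma point_ideal_principal:
  assumes E: "elliptic_curve A B" and P: "on_curve A B P" and "point_ideal P \<approx> {1}"
  shows "P = Infinity"
proof (cases P)
  case (Affine a b)
  obtain c where c: "c \<noteq> 0" "rspan (point_ideal P) = rspan {c}"
    using assms by (auto simp: equivalent_def)
  obtain e where e: "e \<noteq> 0" "c = fls_const e"
    using point_ideal_principal_aux c unfolding Affine by blast
  have "1 \<in> rspan {c}"
    using e rspan_multiple [of "fls_const (inverse e)" c] by simp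
  then have "rspan (point_ideal P) = rspan {1}"
    using c rspan_least [of "point_ideal P" "{1}"] point_ideal_subset [of P]
      rspan_least [of "{1}" "{c}"] by (auto simp: rspan_singleton)
  from rspan_times_cong [OF this, of "point_ideal (ec_neg P)"]
  have "rspan (point_ideal (Affine a (- b))) = rspan {x - fls_const a}"
    using point_ideal_neg_times [of a b] P E by (simp add: Affine)
  then obtain d where "x - fls_const a = fls_const d"
    using point_ideal_principal_aux x_minus_const(1) by blast
  then show ?thesis
    using x_minus_const(2) [of a] by simp
qed simp

lemma point_ideal_inject:
  assumes E: "elliptic_curve A B" and P: "on_curve A B P" and Q: "on_curve A B Q"
    and "point_ideal P \<approx> point_ideal Q"
  shows "P = Q"
proof -
  have "point_ideal (ec_add A P (ec_neg Q)) \<approx> point_ideal P * point_ideal (ec_neg Q)"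
    using P Q by (intro point_ideal_add E) auto
  also have "\<dots> \<approx> point_ideal Q * point_ideal (ec_neg Q)"
    by (intro equivalent_times assms)
  also have "\<dots> \<approx> {1}"
    by (intro point_ideal_neg Q E)
  finally have "ec_add A P (ec_neg Q) = Infinity"
    using P Q by (intro point_ideal_principal E on_curve_ec_add) auto
  then show ?thesis
    by (metis ec_add_eq_Infinity_iff ec_neg_ec_neg)
qed

lemma ec_add_assoc:
  assumes E: "elliptic_curve A B" and on: "on_curve A B P" "on_curve A B Q" "on_curve A B R"
  shows "ec_add A (ec_add A P Q) R = ec_add A P (ec_add A Q R)"
proof (rule point_ideal_inject [OF E])
  have "point_ideal (ec_add A (ec_add A P Q) R) \<approx> point_ideal (ec_add A P Q) * point_ideal R"
    by (intro point_ideal_add E on on_curve_ec_add)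
  also have "\<dots> \<approx> point_ideal P * point_ideal Q * point_ideal R"
    by (intro equivalent_times2 point_ideal_add E on equivalent_refl)
  finally have 1: "point_ideal (ec_add A (ec_add A P Q) R)
      \<approx> point_ideal P * (point_ideal Q * point_ideal R)"
    by (simp only: mult.assoc)
  have "point_ideal (ec_add A P (ec_add A Q R)) \<approx> point_ideal P * point_ideal (ec_add A Q R)"
    by (intro point_ideal_add E on on_curve_ec_add)
  also have "\<dots> \<approx> point_ideal P * (point_ideal Q * point_ideal R)"
    by (intro equivalent_times2 point_ideal_add E on equivalent_refl)
  finally
  show "point_ideal (ec_add A (ec_add A P Q) R) \<approx> point_ideal (ec_add A P (ec_add A Q R))"
    using 1 equivalent_sym equivalent_trans by blast
qed (intro on_curve_ec_add on)+

end

section \<open>Existence of the expansions, and the group of rational points\<close>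

lemma function_field_exists:
  fixes A B :: "'a::field_char_0"
  shows "\<exists>x y. function_field A B x y"
proof -
  \<comment> \<open>With x = T^2 and T = 1/X the right-hand side of the curve equation is T^6 times
    \<open>g\<close>. The constant term of \<open>g\<close> is 1, so it has a square root as a power
    series.\<close>
  define g :: "'a fps" where "g = 1 + fps_const A * fps_X ^ 4 + fps_const B * fps_X ^ 6"
  have g0: "g $ 0 = 1"
    by (simp add: g_def)
  define h where "h = fps_radical (\<lambda>_ _. 1) 2 g"
  have "h ^ 2 = g"
    using power_radical [of g "\<lambda>_ _. 1" 1] g0 by (simp add: h_def flip: numeral_2_eq_2)
  have h0: "h $ 0 = 1"
    by (simp add: h_def)
  define H where "H = fps_to_fls h"
  define T :: "'a fls" where "T = fls_X_inv"
  have XT: "fls_X * T = 1"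
    unfolding T_def fls_inverse_X [symmetric] by (rule right_inverse) simp
  have "H ^ 2 = fps_to_fls g"
    by (metis H_def \<open>h ^ 2 = g\<close> fps_to_fls_power)
  then have H: "H ^ 2 = 1 + fls_const A * fls_X ^ 4 + fls_const B * fls_X ^ 6"
    by (simp add: g_def fls_times_fps_to_fls fps_to_fls_power del: fls_const_mult_const)
  have "function_field A B (T ^ 2) (T ^ 3 * H)"
  proof
    show "(T ^ 3 * H) ^ 2 = (T ^ 2) ^ 3 + fls_const A * T ^ 2 + fls_const B"
    proof -
      have "(T ^ 3 * H) ^ 2 = T ^ 6 * H ^ 2"
        by algebra
      also have "\<dots> = (T ^ 2) ^ 3 + fls_const A * T ^ 2 + fls_const B"
        unfolding H using XT by algebra
      finally show ?thesis .
    qed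
    show "fls_subdegree (T ^ 2) = - 2"
      by (simp add: T_def)
    have "H \<noteq> 0" "subdegree h = 0"
      using h0 by (auto simp: H_def subdegree_eq_0)
    then show "fls_subdegree (T ^ 3 * H) = - 3"
      by (simp add: T_def H_def fls_subdegree_fls_to_fps)
  qed
  then show ?thesis
    by blast
qed

lemma ec_add_assoc:
  assumes "elliptic_curve A B" "on_curve A B P" "on_curve A B Q" "on_curve A B R"
  shows "ec_add A (ec_add A P Q) R = ec_add A P (ec_add A Q R)"
  using function_field_exists [of A B] function_field.ec_add_assoc assms by blast

lemma ec_group_simps [simp]:
  "carrier (ec_group A B) = {P. on_curve A B P}"
  "P \<otimes>\<^bsub>ec_group A B\<^esub> Q = ec_add A P Q"
  "\<one>\<^bsub>ec_group A B\<^esub> = Infinity"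
  by (simp_all add: ec_group_def)

lemma comm_group_ec_group:
  assumes "elliptic_curve A B"
  shows "comm_group (ec_group A B)"
proof (rule comm_groupI)
  fix P assume "P \<in> carrier (ec_group A B)"
  then show "\<exists>Q\<in>carrier (ec_group A B). Q \<otimes>\<^bsub>ec_group A B\<^esub> P = \<one>\<^bsub>ec_group A B\<^esub>"
    by (intro bexI [of _ "ec_neg P"]) (auto simp: ec_add_ec_neg)
qed (use assms in \<open>auto simp: ec_add_assoc intro: on_curve_ec_add ec_add_commute\<close>)

section \<open>Three quartic equations\<close>

lemma coprime_int_primeI:
  fixes a b :: int
  assumes "\<And>p. prime p \<Longrightarrow> p dvd a \<Longrightarrow> p dvd b \<Longrightarrow> False"
  shows "coprime a b"
proof (rule ccontr)
  assume nc: "\<not> coprime a b"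
  show False
  proof (cases "gcd a b = 0")
    case True
    then show ?thesis
      using assms [of 2] by auto
  next
    case False
    moreover have "\<not> is_unit (gcd a b)"
      using nc is_unit_gcd by blast
    ultimately obtain p where "p dvd gcd a b" "prime p"
      using prime_divisor_exists by blast
    then show False
      using assms by auto
  qed
qed

lemma coprime_power_factors_int:
  fixes a b w :: int
  assumes "a * b = w ^ n" "n > 0" "a > 0" "b > 0" "w > 0"
    and common: "\<And>p. prime p \<Longrightarrow> p dvd w \<Longrightarrow> p dvd a \<Longrightarrow> p dvd b \<Longrightarrow> False"
  obtains g h where "g > 0" "h > 0" "coprime g h" "w = g * h" "a = g ^ n" "b = h ^ n"
proof -
  have cop: "coprime a b"
  proof (rule coprime_int_primeI)
    fix p :: int assume p: "prime p" "p dvd a" "p dvd b"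
    then have "p dvd w ^ n"
      using assms(1) by (metis dvd_mult2)
    then show False
      using p common prime_dvd_power by blast
  qed
  have "nat a * nat b = nat w ^ n"
    using assms by (metis nat_mult_distrib nat_power_eq less_imp_le)
  moreover have "coprime (nat a) (nat b)"
    using cop assms by (metis coprime_int_iff int_nat_eq less_imp_le)
  ultimately have "is_nth_power n (nat a)" "is_nth_power n (nat b)"
    using is_nth_power_mult_coprime_nat_iff [of "nat a" "nat b" n] by (metis is_nth_power_def)+
  then obtain g h where gh: "nat a = g ^ n" "nat b = h ^ n"
    by (auto simp: is_nth_power_def)
  have ab: "a = int g ^ n" "b = int h ^ n"
    using assms gh by (metis int_nat_eq less_imp_le of_nat_power)+
  have pos: "int g > 0" "int h > 0"
    using assms ab by (auto intro!: Nat.gr0I simp: zero_power)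
  have "(int g * int h) ^ n = w ^ n"
    using assms ab by (simp add: power_mult_distrib)
  then have w: "w = int g * int h"
    using pos assms by (metis mult_nonneg_nonneg less_imp_le power_eq_imp_eq_base)
  have "coprime (int g) (int h)"
    using cop \<open>n > 0\<close> unfolding ab by simp
  then show ?thesis
    using that ab pos w by blast
qed

lemma coprime_prime_power_factors_int:
  fixes a b w q :: int
  assumes "a * b = q * w ^ n" "prime q" "n > 1" "a > 0" "b > 0" "w > 0"
    and common: "\<And>p. prime p \<Longrightarrow> p dvd w \<Longrightarrow> p dvd a \<Longrightarrow> p dvd b \<Longrightarrow> False"
  obtains g h where "g > 0" "h > 0" "coprime g h" "w = g * h"
    "a = q * g ^ n \<and> b = h ^ n \<or> a = g ^ n \<and> b = q * h ^ n"
proof -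
  have "q > 0"
    using assms by (simp add: prime_gt_0_int)
  have "q dvd a \<or> q dvd b"
    using assms by (metis dvd_triv_left prime_dvd_mult_iff)
  then show ?thesis
  proof
    assume "q dvd a"
    then obtain a' where a: "a = q * a'" ..
    have *: "a' * b = w ^ n" "a' > 0"
      using assms a \<open>q > 0\<close> by (auto simp: zero_less_mult_iff)
    obtain g h where "g > 0" "h > 0" "coprime g h" "w = g * h" "a' = g ^ n" "b = h ^ n"
    proof (rule coprime_power_factors_int)
      fix p assume "prime p" "p dvd w" "p dvd a'" "p dvd b"
      then show False
        using common [of p] a by simp
    qed (use assms * in auto)
    then show ?thesis
      using that a by blast
  next
    assume "q dvd b"
    then obtain b' where b: "b = q * b'" ..
    have *: "a * b' = w ^ n" "b' > 0"
      using assms b \<open>q > 0\<close> by (auto simp: zero_less_mult_iff)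
    obtain g h where "g > 0" "h > 0" "coprime g h" "w = g * h" "a = g ^ n" "b' = h ^ n"
    proof (rule coprime_power_factors_int)
      fix p assume "prime p" "p dvd w" "p dvd a" "p dvd b'"
      then show False
        using common [of p] b by simp
    qed (use assms * in auto)
    then show ?thesis
      using that b by blast
  qed
qed

lemma odd_square_mod_8: "odd (x::int) \<Longrightarrow> x ^ 2 mod 8 = 1"
proof -
  assume "odd x"
  then obtain k where k: "x = 2 * k + 1" by (elim oddE)
  have "even (k * (k + 1))" by simp
  then obtain j where "k * (k + 1) = 2 * j" by (elim evenE)
  then have "x ^ 2 = 1 + 8 * j" unfolding k by algebra
  then show ?thesis by simp
qed

lemma square_mod_4: "(x::int) ^ 2 mod 4 = (if even x then 0 else 1)"
proof (cases "even x")
  case True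
  then obtain k where "x = 2 * k" by (elim evenE)
  then show ?thesis by (simp add: power2_eq_square)
next
  case False
  then show ?thesis using odd_square_mod_8 [of x] by presburger
qed

lemma three_dvd_sum_squares:
  fixes a b :: int
  assumes "3 dvd a ^ 2 + b ^ 2" shows "3 dvd a"
proof -
  have sq: "x ^ 2 mod 3 = (if 3 dvd x then 0 else 1)" for x :: int
  proof -
    have "x mod 3 = 0 \<or> x mod 3 = 1 \<or> x mod 3 = 2" by presburger
    moreover have "x ^ 2 mod 3 = (x mod 3) ^ 2 mod 3" by (simp add: power_mod)
    ultimately show ?thesis by auto
  qed
  show ?thesis
    using assms sq [of a] sq [of b] by presburger
qed

lemma odd_prime_dvd_double:
  fixes p :: int
  assumes "prime p" "p dvd w" "odd w" "p dvd 2 * x" shows "p dvd x"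
proof -
  have "\<not> p dvd 2"
  proof
    assume "p dvd 2"
    then have "p = 2"
      using assms(1) by (intro primes_dvd_imp_eq) auto
    then show False
      using assms by simp
  qed
  then show ?thesis
    using assms by (simp add: prime_dvd_mult_iff)
qed

lemma dvd_linear:
  fixes p :: int
  assumes "p dvd w" "p dvd a" "p dvd b"
  shows "p dvd a + b - k * w ^ 2" "p dvd b - a + k * w ^ 2"
  using assms by (auto simp: power2_eq_square intro!: dvd_add dvd_diff)

lemma coprime_no_prime: "coprime (x::int) y \<Longrightarrow> prime p \<Longrightarrow> p dvd x \<Longrightarrow> p dvd y \<Longrightarrow> False"
  by (metis coprime_common_divisor not_prime_unit)

text \<open>
  One round of 2-descent turns the solution \<open>(x, y)\<close> into the solution \<open>(h, g)\<close>. The factor \<open>c\<close> is 1 for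
  odd \<open>y\<close> and 2 for even \<open>y\<close>.
\<close>

lemma quartic_descent:
  fixes t :: int
  assumes "t \<noteq> 0"
    and step: "\<And>x y z. x > 0 \<Longrightarrow> y > 0 \<Longrightarrow> coprime x y \<Longrightarrow>
      z ^ 2 = x ^ 4 - t * x ^ 2 * y ^ 2 + t * y ^ 4 \<Longrightarrow>
      \<exists>c g h \<beta>. c \<in> {1, 2} \<and> g > 0 \<and> h > 0 \<and> \<beta> > 0 \<and> coprime h g \<and> y = c * (g * h * \<beta>) \<and>
        \<beta> ^ 2 = h ^ 4 - t * h ^ 2 * g ^ 2 + t * g ^ 4 \<and> (g = 1 \<and> h = 1 \<and> \<beta> = 1 \<longrightarrow> x ^ 2 = c ^ 2)"
    and "x > 0" "y > 0" "coprime x y" "z ^ 2 = x ^ 4 - t * x ^ 2 * y ^ 2 + t * y ^ 4"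
  shows "x = 1 \<and> y = 1"
  using assms(3-)
proof (induction "nat y" arbitrary: x y z rule: less_induct)
  case less
  obtain c g h \<beta> where *: "c \<in> {1, 2}" "g > 0" "h > 0" "\<beta> > 0" "coprime h g" "y = c * (g * h * \<beta>)"
    "\<beta> ^ 2 = h ^ 4 - t * h ^ 2 * g ^ 2 + t * g ^ 4" "g = 1 \<and> h = 1 \<and> \<beta> = 1 \<longrightarrow> x ^ 2 = c ^ 2"
    using step [OF less.prems] by blast
  have one: "g = 1 \<and> h = 1 \<and> \<beta> = 1"
  proof (cases "g < y")
    case True
    then have "h = 1 \<and> g = 1"
      using less.hyps [of g h \<beta>] less.prems(2) * by simp
    moreover from this have "\<beta> ^ 2 = 1"
      using *(7) by simp
    ultimately show ?thesis
      using *(4) by (simp add: power2_eq_1_iff)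
  next
    case False
    \<comment> \<open>If \<open>g\<close> is not smaller than \<open>y\<close>, the factorisation of
      \<open>y\<close> forces all other factors to be 1. The equation then leaves only
      \<open>g = 1\<close>, so the induction hypothesis is not called for.\<close>
    have "c * (h * \<beta>) = 1"
    proof -
      have "c * (h * \<beta>) > 0" using *(1,3,4) by auto
      moreover have "g * (c * (h * \<beta>)) \<le> g * 1"
        using False *(6) by (simp add: mult_ac)
      ultimately show ?thesis
        using *(2) by (simp only: mult_le_cancel_left_pos)
    qed
    then have h: "h = 1" "\<beta> = 1"
      using *(1,3,4) by (auto simp: zmult_eq_1_iff)
    then have "t * (g ^ 2 * (g ^ 2 - 1)) = 0"
      using *(7) by algebra
    then have "g ^ 2 = 1"
      using \<open>t \<noteq> 0\<close> *(2) by simp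
    then show ?thesis
      using h *(2) by (simp add: power2_eq_1_iff)
  qed
  \<comment> \<open>The trivial solution is reached only from \<open>x = y = c\<close>, and
    coprimality rules out \<open>c = 2\<close>.\<close>
  then have "x = c" "y = c"
    using *(1,6,8) less.prems(1) by (auto simp: power2_eq_iff)
  then show ?case
    using *(1) \<open>coprime x y\<close> by auto
qed

text \<open>Completing the square gives (2 x^2 + y^2)^2 - (2 z)^2 = 5 y^4. Splitting the right-hand
  side into coprime factors expresses x^2 as a square plus a fourth power (times 4 for even
  \<open>y\<close>), and a second splitting of this kind returns to the same quartic.\<close>

lemma quartic_minus_one:
  fixes x y z :: int
  assumes "x > 0" "y > 0" "coprime x y" "z ^ 2 = x ^ 4 + x ^ 2 * y ^ 2 - y ^ 4"
  shows "x = 1 \<and> y = 1"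
proof (rule quartic_descent [of "- 1" x y z])
  fix x y z :: int
  assume xy: "x > 0" "y > 0" and cop: "coprime x y"
    and "z ^ 2 = x ^ 4 - (- 1) * x ^ 2 * y ^ 2 + (- 1) * y ^ 4"
  then have eq: "z ^ 2 = x ^ 4 + x ^ 2 * y ^ 2 - y ^ 4"
    by simp
  have noprime: False if "prime p" "p dvd x" "p dvd y" for p
    using coprime_no_prime [OF cop that] .
  have "odd x"
  proof
    assume "even x"
    then obtain k where k: "x = 2 * k" by (elim evenE)
    have "odd y" using \<open>even x\<close> cop coprime_common_divisor_int [of x y 2] by auto
    then have "(y ^ 2) ^ 2 mod 4 = 1" using square_mod_4 [of "y ^ 2"] by simp
    moreover have "z ^ 2 = 4 * (4 * k ^ 4 + k ^ 2 * y ^ 2) - (y ^ 2) ^ 2"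
      using eq unfolding k by algebra
    ultimately show False
      using square_mod_4 [of z] by presburger
  qed
  \<comment> \<open>The second splitting, common to both parities of \<open>y\<close>: with A = g^4,
    B = h^4 and \<alpha> = g h, the relation B - A = \<beta>^2 - \<alpha>^2 is the quartic for (h,
    g).\<close>
  have final: "\<exists>c g h \<beta>. c \<in> {1, 2} \<and> g > 0 \<and> h > 0 \<and> \<beta> > 0 \<and> coprime h g \<and> y = c * (g * h * \<beta>) \<and>
        \<beta> ^ 2 = h ^ 4 - (- 1) * h ^ 2 * g ^ 2 + (- 1) * g ^ 4 \<and> (g = 1 \<and> h = 1 \<and> \<beta> = 1 \<longrightarrow> x ^ 2 = c ^ 2)"
    if c: "c \<in> {1, 2}" and y: "y = c * (\<alpha> * \<beta>)" and pos: "\<alpha> > 0" "\<beta> > 0"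
      and fac: "A * B = \<alpha> ^ 4" and diff: "B - A = \<beta> ^ 2 - \<alpha> ^ 2" "c * (A + B) = 2 * x"
      and common: "\<And>p. prime p \<Longrightarrow> p dvd \<alpha> \<Longrightarrow> p dvd A + B \<Longrightarrow> p dvd x" for c \<alpha> \<beta> A B :: int
  proof -
    have "A * B > 0" using fac pos by simp
    moreover have "A + B > 0" using diff(2) c xy by auto
    ultimately have AB: "A > 0" "B > 0"
      by (auto simp: zero_less_mult_iff)
    obtain g h where gh: "g > 0" "h > 0" "coprime g h" "\<alpha> = g * h" "A = g ^ 4" "B = h ^ 4"
    proof (rule coprime_power_factors_int [OF fac _ AB pos(1)])
      fix p assume p: "prime p" "p dvd \<alpha>" "p dvd A" "p dvd B"
      then have "p dvd y" unfolding y by simp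
      then show False using common noprime p by (meson dvd_add)
    qed auto
    have "\<beta> ^ 2 = h ^ 4 + h ^ 2 * g ^ 2 - g ^ 4"
      using diff gh by algebra
    moreover have "x ^ 2 = c ^ 2" if "g = 1 \<and> h = 1 \<and> \<beta> = 1"
      using that diff(2) gh by simp
    ultimately show ?thesis
      using c pos gh y by (intro exI [of _ c] exI [of _ g] exI [of _ h] exI [of _ \<beta>])
        (simp add: coprime_commute)
  qed
  show "\<exists>c g h \<beta>. c \<in> {1, 2} \<and> g > 0 \<and> h > 0 \<and> \<beta> > 0 \<and> coprime h g \<and> y = c * (g * h * \<beta>) \<and>
        \<beta> ^ 2 = h ^ 4 - (- 1) * h ^ 2 * g ^ 2 + (- 1) * g ^ 4 \<and> (g = 1 \<and> h = 1 \<and> \<beta> = 1 \<longrightarrow> x ^ 2 = c ^ 2)"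
  proof (cases "odd y")
    case True
    define A B where "A = 2 * x ^ 2 + y ^ 2 - 2 * z" and "B = 2 * x ^ 2 + y ^ 2 + 2 * z"
    have AB: "A * B = 5 * y ^ 4" using eq unfolding A_def B_def by algebra
    then have "A * B > 0" using xy by simp
    moreover have "A + B > 0" using xy by (simp add: A_def B_def add_pos_pos)
    ultimately have pos: "A > 0" "B > 0"
      by (auto simp: zero_less_mult_iff)
    obtain g h where gh: "g > 0" "h > 0" "coprime g h" "y = g * h"
      "A = 5 * g ^ 4 \<and> B = h ^ 4 \<or> A = g ^ 4 \<and> B = 5 * h ^ 4"
    proof (rule coprime_prime_power_factors_int [OF AB _ _ pos \<open>y > 0\<close>])
      fix p assume p: "prime p" "p dvd y" "p dvd A" "p dvd B"
      then have "p dvd A + B - 2 * y ^ 2" by (intro dvd_linear)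
      then have "p dvd 2 * (2 * x ^ 2)" by (simp add: A_def B_def)
      then have "p dvd x ^ 2" using odd_prime_dvd_double p True by blast
      then show False using noprime p prime_dvd_power by blast
    qed auto
    \<comment> \<open>\<open>\<alpha>\<close> belongs to the factor that carries the 5. Swapping the
      two factors only changes the sign of \<open>z\<close>.\<close>
    from gh(5) obtain \<alpha> \<beta> where \<alpha>: "\<alpha> > 0" "\<beta> > 0" "y = \<alpha> * \<beta>" "A + B = 5 * \<alpha> ^ 4 + \<beta> ^ 4"
      using that [of g h] that [of h g] gh by auto
    have odd: "odd \<alpha>" "odd \<beta>" using True \<alpha> by auto
    have "even ((\<beta> ^ 2 - \<alpha> ^ 2) div 2)" "even (\<beta> ^ 2 - \<alpha> ^ 2)"
      using odd_square_mod_8 [OF odd(1)] odd_square_mod_8 [OF odd(2)] by presburger+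
    then obtain D where D: "\<beta> ^ 2 - \<alpha> ^ 2 = 2 * D" by (elim evenE)
    have "4 * x ^ 2 + 2 * (\<alpha> * \<beta>) ^ 2 = 5 * \<alpha> ^ 4 + \<beta> ^ 4"
      using \<alpha>(3,4) by (simp add: A_def B_def)
    \<comment> \<open>The relation above amounts to 4 x^2 = (\<beta>^2 - \<alpha>^2)^2 + 4
      \<alpha>^4, hence x^2 - D^2 = \<alpha>^4.\<close>
    then have fac: "(x - D) * (x + D) = \<alpha> ^ 4" using D by algebra
    have common: "p dvd x" if "prime p" "p dvd \<alpha>" "p dvd (x - D) + (x + D)" for p
    proof (rule odd_prime_dvd_double [OF that(1,2) odd(1)])
      have "(x - D) + (x + D) = 2 * x" by simp
      then show "p dvd 2 * x" using that(3) by metis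
    qed
    show ?thesis
      by (rule final [of 1 \<alpha> \<beta> "x - D" "x + D", OF _ _ _ _ fac _ _ common]) (use \<alpha> D in auto)
  next
    case False
    then have "even y" by simp
    then obtain w where w: "y = 2 * w" by (elim evenE)
    have "z ^ 2 = x ^ 2 * x ^ 2 + 4 * (x ^ 2 * w ^ 2 - 4 * w ^ 4)" using eq unfolding w by algebra
    then have "odd (z ^ 2)" using \<open>odd x\<close> by simp
    then have "odd z" by simp
    \<comment> \<open>For y = 2 w the first splitting is (x^2 + 2 w^2)^2 - z^2 = 20 w^4, and a
      factor 2 comes out of each side of the product.\<close>
    have "even (x ^ 2 + 2 * w ^ 2 - z)" "even (x ^ 2 + 2 * w ^ 2 + z)" using \<open>odd x\<close> \<open>odd z\<close> by simp_all
    then obtain A B where A: "x ^ 2 + 2 * w ^ 2 - z = 2 * A" and B: "x ^ 2 + 2 * w ^ 2 + z = 2 * B"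
      by (elim evenE)
    have "4 * (A * B) = 4 * (5 * w ^ 4)" using eq A B unfolding w by algebra
    then have AB: "A * B = 5 * w ^ 4" by simp
    have "w > 0" using xy w by simp
    then have "A * B > 0" using AB by simp
    moreover have sum: "A + B = x ^ 2 + 2 * w ^ 2" using A B by simp
    moreover have "x ^ 2 + 2 * w ^ 2 > 0" using xy by (simp add: add_pos_nonneg)
    ultimately have pos: "A > 0" "B > 0"
      by (auto simp: zero_less_mult_iff)
    obtain g h where gh: "g > 0" "h > 0" "coprime g h" "w = g * h"
      "A = 5 * g ^ 4 \<and> B = h ^ 4 \<or> A = g ^ 4 \<and> B = 5 * h ^ 4"
    proof (rule coprime_prime_power_factors_int [OF AB _ _ pos \<open>w > 0\<close>])
      fix p assume p: "prime p" "p dvd w" "p dvd A" "p dvd B"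
      then have "p dvd A + B - 2 * w ^ 2" by (intro dvd_linear)
      then have "p dvd x ^ 2" by (simp add: sum)
      then show False using noprime p w prime_dvd_power by (metis dvd_mult)
    qed auto
    from gh(5) obtain \<alpha> \<beta> where \<alpha>: "\<alpha> > 0" "\<beta> > 0" "w = \<alpha> * \<beta>" "A + B = 5 * \<alpha> ^ 4 + \<beta> ^ 4"
      using that [of g h] that [of h g] gh by auto
    define D where "D = \<beta> ^ 2 - \<alpha> ^ 2"
    have x2: "x ^ 2 + 2 * (\<alpha> * \<beta>) ^ 2 = 5 * \<alpha> ^ 4 + \<beta> ^ 4"
      using sum \<alpha> by simp
    then have xD: "x ^ 2 = D ^ 2 + 2 * (2 * \<alpha> ^ 4)" unfolding D_def by algebra
    have "odd (x ^ 2)" using \<open>odd x\<close> by simp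
    then have "odd (D ^ 2)" unfolding xD by simp
    then have "odd D" by simp
    have "even (x - D)" "even (x + D)" using \<open>odd x\<close> \<open>odd D\<close> by simp_all
    then obtain M N where M: "x - D = 2 * M" and N: "x + D = 2 * N" by (elim evenE)
    have "4 * (M * N) = 4 * \<alpha> ^ 4" using xD M N by algebra
    then have fac: "M * N = \<alpha> ^ 4" by simp
    have MN: "N - M = \<beta> ^ 2 - \<alpha> ^ 2" "M + N = x" using M N by (simp_all add: D_def)
    show ?thesis
      by (rule final [of 2 \<alpha> \<beta> M N, OF _ _ _ _ fac]) (use \<alpha> w MN in auto)
  qed
qed (use assms in simp_all)

text \<open>Here the square is completed as (2 z)^2 - (2 x^2 - 3 y^2)^2 = 3 y^4. Reduction modulo 3
  decides which factor carries the 3, since the other choice would force 3 to divide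
  \<open>x\<close>. The second splitting again has right-hand side 3 times a fourth power.\<close>

lemma quartic_three:
  fixes x y z :: int
  assumes "x > 0" "y > 0" "coprime x y" "z ^ 2 = x ^ 4 - 3 * x ^ 2 * y ^ 2 + 3 * y ^ 4"
  shows "x = 1 \<and> y = 1"
proof (rule quartic_descent [of 3 x y z])
  fix x y z' :: int
  assume xy: "x > 0" "y > 0" and cop: "coprime x y"
    and eq': "z' ^ 2 = x ^ 4 - 3 * x ^ 2 * y ^ 2 + 3 * y ^ 4"
  define z where "z = \<bar>z'\<bar>"
  have eq: "z ^ 2 = x ^ 4 - 3 * x ^ 2 * y ^ 2 + 3 * y ^ 4"
    using eq' by (simp add: z_def)
  have "4 * z ^ 2 = (2 * x ^ 2 - 3 * y ^ 2) ^ 2 + 3 * y ^ 4"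
    using eq by algebra
  moreover have "y ^ 4 > 0" using xy by simp
  ultimately have "z ^ 2 \<noteq> 0"
    using zero_le_power2 [of "2 * x ^ 2 - 3 * y ^ 2"] by linarith
  then have "z > 0" by (simp add: z_def)
  have noprime: False if "prime p" "p dvd x" "p dvd y" for p
    using coprime_no_prime [OF cop that] .
  have "odd x"
  proof
    assume "even x"
    then obtain k where k: "x = 2 * k" by (elim evenE)
    have "odd y" using \<open>even x\<close> cop coprime_common_divisor_int [of x y 2] by auto
    then have "(y ^ 2) ^ 2 mod 4 = 1" using square_mod_4 [of "y ^ 2"] by simp
    moreover have "z ^ 2 = 4 * (4 * k ^ 4 - 3 * k ^ 2 * y ^ 2) + 3 * (y ^ 2) ^ 2"
      using eq unfolding k by algebra
    moreover have "(4 * K + 3 * Y) mod 4 = 3" if "Y mod 4 = 1" for K Y :: int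
      using that by presburger
    ultimately have "z ^ 2 mod 4 = 3"
      by metis
    then show False
      using square_mod_4 [of z] by (simp split: if_splits)
  qed
  have "\<not> 3 dvd x"
  proof
    assume "3 dvd x"
    then obtain k where k: "x = 3 * k" ..
    have "z ^ 2 = 3 * (27 * k ^ 4 - 9 * k ^ 2 * y ^ 2 + y ^ 4)"
      using eq unfolding k by algebra
    then have "3 dvd z ^ 2" by simp
    then have "3 dvd z" by (rule prime_dvd_power [rotated]) simp
    then obtain j where "z = 3 * j" ..
    then have "3 * y ^ 4 = 3 * (3 * (j ^ 2 - 9 * k ^ 4 + 3 * k ^ 2 * y ^ 2))"
      using eq unfolding k by algebra
    then have "y ^ 4 = 3 * (j ^ 2 - 9 * k ^ 4 + 3 * k ^ 2 * y ^ 2)" by linarith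
    then have "3 dvd y ^ 4" by (rule dvdI)
    then have "3 dvd y" by (rule prime_dvd_power [rotated]) simp
    then show False using noprime [of 3] \<open>3 dvd x\<close> by simp
  qed
  have final: "\<exists>c g h \<beta>. c \<in> {1, 2} \<and> g > 0 \<and> h > 0 \<and> \<beta> > 0 \<and> coprime h g \<and> y = c * (g * h * \<beta>) \<and>
        \<beta> ^ 2 = h ^ 4 - 3 * h ^ 2 * g ^ 2 + 3 * g ^ 4 \<and> (g = 1 \<and> h = 1 \<and> \<beta> = 1 \<longrightarrow> x ^ 2 = c ^ 2)"
    if c: "c \<in> {1, 2}" and y: "y = c * (\<alpha> * \<beta>)" and pos: "\<alpha> > 0" "\<beta> > 0"
      and fac: "A * B = 3 * \<alpha> ^ 4" and sum: "c * (B - A) = 2 * x" "A + B = \<beta> ^ 2 + 3 * \<alpha> ^ 2"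
      and common: "\<And>p. prime p \<Longrightarrow> p dvd \<alpha> \<Longrightarrow> p dvd B - A \<Longrightarrow> p dvd x" for c \<alpha> \<beta> A B :: int
  proof -
    have "A * B > 0" using fac pos by simp
    moreover have "A + B > 0" using sum(2) pos by (simp add: add_pos_pos)
    ultimately have AB: "A > 0" "B > 0"
      by (auto simp: zero_less_mult_iff)
    obtain g h where gh: "g > 0" "h > 0" "coprime g h" "\<alpha> = g * h"
      "A = 3 * g ^ 4 \<and> B = h ^ 4 \<or> A = g ^ 4 \<and> B = 3 * h ^ 4"
    proof (rule coprime_prime_power_factors_int [OF fac _ _ AB pos(1)])
      fix p assume p: "prime p" "p dvd \<alpha>" "p dvd A" "p dvd B"
      then have "p dvd y" unfolding y by simp
      then show False using common noprime p by (meson dvd_diff)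
    qed auto
    \<comment> \<open>Which factor carries the 3 stays open in this splitting, so
      \<open>B - A\<close> is known in terms of \<open>g\<close> and \<open>h\<close> only up to
      sign. This is why the descent step asks for \<open>x ^ 2 = c ^ 2\<close>.\<close>
    then obtain g h where gh: "g > 0" "h > 0" "coprime h g" "\<alpha> = g * h" "A + B = 3 * g ^ 4 + h ^ 4"
      "(B - A) ^ 2 = (3 * g ^ 4 - h ^ 4) ^ 2"
      using that [of g h] that [of h g] by (auto simp: coprime_commute power2_commute)
    have "\<beta> ^ 2 = h ^ 4 - 3 * h ^ 2 * g ^ 2 + 3 * g ^ 4"
      using sum gh by algebra
    moreover have "x ^ 2 = c ^ 2" if "g = 1 \<and> h = 1 \<and> \<beta> = 1"
    proof -
      have "4 * x ^ 2 = c ^ 2 * (B - A) ^ 2" using sum(1) by algebra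
      also have "(B - A) ^ 2 = 4" using gh(6) that by simp
      finally show ?thesis by simp
    qed
    ultimately show ?thesis
      using c pos gh y by (intro exI [of _ c] exI [of _ g] exI [of _ h] exI [of _ \<beta>]) simp
  qed
  show "\<exists>c g h \<beta>. c \<in> {1, 2} \<and> g > 0 \<and> h > 0 \<and> \<beta> > 0 \<and> coprime h g \<and> y = c * (g * h * \<beta>) \<and>
        \<beta> ^ 2 = h ^ 4 - 3 * h ^ 2 * g ^ 2 + 3 * g ^ 4 \<and> (g = 1 \<and> h = 1 \<and> \<beta> = 1 \<longrightarrow> x ^ 2 = c ^ 2)"
  proof (cases "odd y")
    case True
    define A B where "A = 2 * z - 2 * x ^ 2 + 3 * y ^ 2" and "B = 2 * z + 2 * x ^ 2 - 3 * y ^ 2"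
    have AB: "A * B = 3 * y ^ 4" using eq unfolding A_def B_def by algebra
    then have "A * B > 0" using xy by simp
    moreover have "A + B > 0" using \<open>z > 0\<close> by (simp add: A_def B_def)
    ultimately have pos: "A > 0" "B > 0"
      by (auto simp: zero_less_mult_iff)
    obtain g h where gh: "g > 0" "h > 0" "coprime g h" "y = g * h"
      "A = 3 * g ^ 4 \<and> B = h ^ 4 \<or> A = g ^ 4 \<and> B = 3 * h ^ 4"
    proof (rule coprime_prime_power_factors_int [OF AB _ _ pos \<open>y > 0\<close>])
      fix p assume p: "prime p" "p dvd y" "p dvd A" "p dvd B"
      then have "p dvd B - A + 6 * y ^ 2" by (intro dvd_linear)
      then have "p dvd 2 * (2 * x ^ 2)" by (simp add: A_def B_def)
      then have "p dvd x ^ 2" using odd_prime_dvd_double p True by blast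
      then show False using noprime p prime_dvd_power by blast
    qed auto
    have BA: "4 * x ^ 2 = B - A + 6 * (g * h) ^ 2"
      unfolding gh(4) [symmetric] by (simp add: A_def B_def)
    have "\<not> (A = g ^ 4 \<and> B = 3 * h ^ 4)"
    proof
      assume "A = g ^ 4 \<and> B = 3 * h ^ 4"
      then have "(2 * x) ^ 2 + (g ^ 2) ^ 2 = 3 * (h ^ 4 + 2 * (g * h) ^ 2)"
        using BA by algebra
      then have "3 dvd 2 * x" by (metis three_dvd_sum_squares dvd_triv_left)
      then show False using \<open>\<not> 3 dvd x\<close> by presburger
    qed
    then have x2: "4 * x ^ 2 = h ^ 4 - 3 * g ^ 4 + 6 * (g * h) ^ 2"
      using gh(5) BA by auto
    have odd: "odd g" "odd h" using True gh by auto
    have "even (h ^ 2 + 3 * g ^ 2)" using odd by simp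
    then obtain m where m: "h ^ 2 + 3 * g ^ 2 = 2 * m" by (elim evenE)
    \<comment> \<open>By \<open>x2\<close>, 4 x^2 = (h^2 + 3 g^2)^2 - 12 g^4.\<close>
    have "4 * ((m - x) * (m + x)) = 4 * (3 * g ^ 4)" using x2 m by algebra
    then have fac: "(m - x) * (m + x) = 3 * g ^ 4" by simp
    have common: "p dvd x" if "prime p" "p dvd g" "p dvd (m + x) - (m - x)" for p
    proof (rule odd_prime_dvd_double [OF that(1,2) odd(1)])
      have "(m + x) - (m - x) = 2 * x" by simp
      then show "p dvd 2 * x" using that(3) by metis
    qed
    show ?thesis
      by (rule final [of 1 g h "m - x" "m + x", OF _ _ _ _ fac _ _ common]) (use gh m in auto)
  next
    case False
    then have "even y" by simp
    then obtain w where w: "y = 2 * w" by (elim evenE)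
    have "z ^ 2 = x ^ 2 * x ^ 2 + 2 * (24 * w ^ 4 - 6 * x ^ 2 * w ^ 2)" using eq unfolding w by algebra
    then have "odd (z ^ 2)" using \<open>odd x\<close> by simp
    then have "odd z" by simp
    have "even (z - x ^ 2 + 6 * w ^ 2)" "even (z + x ^ 2 - 6 * w ^ 2)" using \<open>odd x\<close> \<open>odd z\<close> by simp_all
    then obtain A B where A: "z - x ^ 2 + 6 * w ^ 2 = 2 * A" and B: "z + x ^ 2 - 6 * w ^ 2 = 2 * B"
      by (elim evenE)
    have "4 * (A * B) = 4 * (3 * w ^ 4)" using eq A B unfolding w by algebra
    then have AB: "A * B = 3 * w ^ 4" by simp
    have "w > 0" using xy w by simp
    then have "A * B > 0" using AB by simp
    moreover have "A + B > 0" using A B \<open>z > 0\<close> by simp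
    ultimately have pos: "A > 0" "B > 0"
      by (auto simp: zero_less_mult_iff)
    have BA: "B - A = x ^ 2 - 6 * w ^ 2" using A B by simp
    obtain g h where gh: "g > 0" "h > 0" "coprime g h" "w = g * h"
      "A = 3 * g ^ 4 \<and> B = h ^ 4 \<or> A = g ^ 4 \<and> B = 3 * h ^ 4"
    proof (rule coprime_prime_power_factors_int [OF AB _ _ pos \<open>w > 0\<close>])
      fix p assume p: "prime p" "p dvd w" "p dvd A" "p dvd B"
      then have "p dvd B - A + 6 * w ^ 2" by (intro dvd_linear)
      then have "p dvd x ^ 2" by (simp add: BA)
      then show False using noprime p w prime_dvd_power by (metis dvd_mult)
    qed auto
    have "\<not> (A = g ^ 4 \<and> B = 3 * h ^ 4)"
    proof
      assume "A = g ^ 4 \<and> B = 3 * h ^ 4"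
      then have "x ^ 2 + (g ^ 2) ^ 2 = 3 * (h ^ 4 + 2 * (g * h) ^ 2)"
        using BA gh(4) by algebra
      then have "3 dvd x" by (metis three_dvd_sum_squares dvd_triv_left)
      then show False using \<open>\<not> 3 dvd x\<close> by simp
    qed
    then have x2: "x ^ 2 = h ^ 4 - 3 * g ^ 4 + 6 * (g * h) ^ 2"
      using gh(4,5) BA by auto
    define D where "D = h ^ 2 + 3 * g ^ 2"
    have xD: "x ^ 2 = D ^ 2 - 2 * (6 * g ^ 4)" using x2 unfolding D_def by algebra
    have "odd (x ^ 2)" using \<open>odd x\<close> by simp
    then have "odd (D ^ 2)" unfolding xD by simp
    then have "odd D" by simp
    have "even (D - x)" "even (D + x)" using \<open>odd x\<close> \<open>odd D\<close> by simp_all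
    then obtain M N where M: "D - x = 2 * M" and N: "D + x = 2 * N" by (elim evenE)
    have "4 * (M * N) = 4 * (3 * g ^ 4)" using xD M N by algebra
    then have fac: "M * N = 3 * g ^ 4" by simp
    have MN: "M + N = h ^ 2 + 3 * g ^ 2" "N - M = x" using M N by (simp_all add: D_def)
    show ?thesis
      by (rule final [of 2 g h M N, OF _ _ _ _ fac]) (use gh w MN in auto)
  qed
qed (use assms in simp_all)

text \<open>The quartic is symmetric in \<open>x\<close> and \<open>y\<close>, and the invariant of
  the descent is that one of the two is even. The new pair (g, h) satisfies the same quartic, has an
  even member, and lies below \<open>y\<close> in both entries, so either order may be fed to the
  induction.\<close>

lemma quartic_one_even:
  fixes x y z :: int
  assumes "x > 0" "y > 0" "coprime x y" "even y" "z ^ 2 = x ^ 4 - x ^ 2 * y ^ 2 + y ^ 4"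
  shows False
  using assms
proof (induction "nat y" arbitrary: x y z rule: less_induct)
  case less
  note xy = less.prems(1,2) and cop = less.prems(3)
  define z' where "z' = \<bar>z\<bar>"
  have eq: "z' ^ 2 = x ^ 4 - x ^ 2 * y ^ 2 + y ^ 4"
    using less.prems by (simp add: z'_def)
  have "4 * z' ^ 2 = (2 * x ^ 2 - y ^ 2) ^ 2 + 3 * y ^ 4"
    using eq by algebra
  moreover have "y ^ 4 > 0" using xy by simp
  ultimately have "z' ^ 2 \<noteq> 0"
    using zero_le_power2 [of "2 * x ^ 2 - y ^ 2"] by linarith
  then have "z' > 0" by (simp add: z'_def)
  have noprime: False if "prime p" "p dvd x" "p dvd y" for p
    using coprime_no_prime [OF cop that] .
  have "odd x" using \<open>even y\<close> cop coprime_common_divisor_int [of x y 2] by auto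
  obtain w where w: "y = 2 * w" using \<open>even y\<close> by (elim evenE)
  have "z' ^ 2 = x ^ 2 * x ^ 2 + 2 * (8 * w ^ 4 - 2 * x ^ 2 * w ^ 2)" using eq unfolding w by algebra
  then have "odd (z' ^ 2)" using \<open>odd x\<close> by simp
  then have "odd z'" by simp
  have "even (z' - x ^ 2 + 2 * w ^ 2)" "even (z' + x ^ 2 - 2 * w ^ 2)" using \<open>odd x\<close> \<open>odd z'\<close> by simp_all
  then obtain A B where A: "z' - x ^ 2 + 2 * w ^ 2 = 2 * A" and B: "z' + x ^ 2 - 2 * w ^ 2 = 2 * B"
    by (elim evenE)
  have "4 * (A * B) = 4 * (3 * w ^ 4)" using eq A B unfolding w by algebra
  then have AB: "A * B = 3 * w ^ 4" by simp
  have "w > 0" using xy w by simp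
  then have "A * B > 0" using AB by simp
  moreover have "A + B > 0" using A B \<open>z' > 0\<close> by simp
  ultimately have pos: "A > 0" "B > 0"
    by (auto simp: zero_less_mult_iff)
  have BA: "B - A = x ^ 2 - 2 * w ^ 2" using A B by simp
  obtain \<alpha> \<beta> where gh: "\<alpha> > 0" "\<beta> > 0" "coprime \<alpha> \<beta>" "w = \<alpha> * \<beta>"
    "A = 3 * \<alpha> ^ 4 \<and> B = \<beta> ^ 4 \<or> A = \<alpha> ^ 4 \<and> B = 3 * \<beta> ^ 4"
  proof (rule coprime_prime_power_factors_int [OF AB _ _ pos \<open>w > 0\<close>])
    fix p assume p: "prime p" "p dvd w" "p dvd A" "p dvd B"
    then have "p dvd B - A + 2 * w ^ 2" by (intro dvd_linear)
    then have "p dvd x ^ 2" by (simp add: BA)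
    then show False using noprime p w prime_dvd_power by (metis dvd_mult)
  qed auto
  have x1: "x ^ 2 mod 4 = 1" using square_mod_4 [of x] \<open>odd x\<close> by simp
  have "\<not> (A = \<alpha> ^ 4 \<and> B = 3 * \<beta> ^ 4)"
  proof
    assume "A = \<alpha> ^ 4 \<and> B = 3 * \<beta> ^ 4"
    then have "x ^ 2 = 4 * \<beta> ^ 4 - (\<alpha> ^ 2 - \<beta> ^ 2) ^ 2"
      using BA gh(4) by algebra
    then show False
      using x1 square_mod_4 [of "\<alpha> ^ 2 - \<beta> ^ 2"] by presburger
  qed
  then have x2: "x ^ 2 = \<beta> ^ 4 - 3 * \<alpha> ^ 4 + 2 * (\<alpha> * \<beta>) ^ 2"
    using gh(4,5) BA by auto
  define D where "D = \<beta> ^ 2 + \<alpha> ^ 2"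
  have xD: "x ^ 2 = D ^ 2 - 2 * (2 * \<alpha> ^ 4)" using x2 unfolding D_def by algebra
  have "odd (x ^ 2)" using \<open>odd x\<close> by simp
  then have "odd (D ^ 2)" unfolding xD by simp
  then have "odd D" by simp
  have "even (D - x)" "even (D + x)" using \<open>odd x\<close> \<open>odd D\<close> by simp_all
  then obtain M N where M: "D - x = 2 * M" and N: "D + x = 2 * N" by (elim evenE)
  have "4 * (M * N) = 4 * \<alpha> ^ 4" using xD M N by algebra
  then have MN: "M * N = \<alpha> ^ 4" by simp
  then have "M * N > 0" using gh by simp
  moreover have "D > 0" using gh(1,2) by (simp add: D_def add_pos_pos)
  then have "M + N > 0" using M N by simp
  ultimately have pos: "M > 0" "N > 0"
    by (auto simp: zero_less_mult_iff)
  obtain g h where *: "g > 0" "h > 0" "coprime g h" "\<alpha> = g * h" "M = g ^ 4" "N = h ^ 4"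
  proof (rule coprime_power_factors_int [OF MN _ pos \<open>\<alpha> > 0\<close>])
    fix p assume p: "prime p" "p dvd \<alpha>" "p dvd M" "p dvd N"
    then have "p dvd N - M" by simp
    moreover have "N - M = x" using M N by simp
    ultimately show False using noprime [of p] p w gh(4) by simp
  qed auto
  have \<beta>: "\<beta> ^ 2 = h ^ 4 - h ^ 2 * g ^ 2 + g ^ 4"
  proof -
    have "\<beta> ^ 2 + \<alpha> ^ 2 = M + N" using M N D_def by simp
    then show ?thesis using * by algebra
  qed
  have "g * h < y"
  proof -
    have "\<alpha> * 1 \<le> \<alpha> * \<beta>" using gh by (intro mult_left_mono) auto
    then show ?thesis using w gh *(4) by simp
  qed
  moreover have "g * 1 \<le> g * h" "1 * h \<le> g * h"
    using * by (intro mult_left_mono mult_right_mono; simp)+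
  ultimately have less_y: "g < y" "h < y" by simp_all
  have "even g \<or> even h"
  proof (rule ccontr)
    assume odd: "\<not> (even g \<or> even h)"
    then have "odd \<alpha>" using * by simp
    then have "even (\<beta> ^ 2)" using \<open>odd D\<close> by (simp add: D_def)
    moreover have "odd (h ^ 4 - h ^ 2 * g ^ 2 + g ^ 4)" using odd by simp
    ultimately show False unfolding \<beta> by simp
  qed
  then show False
  proof
    assume "even g"
    then show False using less.hyps [of g h \<beta>] less_y * \<beta> by (simp add: coprime_commute)
  next
    assume "even h"
    then show False using less.hyps [of h g \<beta>] less_y * \<beta> by (simp add: algebra_simps)
  qed
qed

text \<open>For odd \<open>x\<close> and \<open>y\<close> the equation is a Pythagorean triple with
  legs |x^2 - y^2| and x y. If x and y differ, its parameters p and q, one of them even, satisfy p^4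
  - p^2 q^2 + q^4 = ((x^2 + y^2) / 2)^2, contradicting the even case.\<close>

lemma quartic_one:
  fixes x y z :: int
  assumes xy: "x > 0" "y > 0" "coprime x y" and "z ^ 2 = x ^ 4 - x ^ 2 * y ^ 2 + y ^ 4"
  shows "x = 1 \<and> y = 1"
proof -
  define z' where "z' = \<bar>z\<bar>"
  have eq: "z' ^ 2 = (x ^ 2 - y ^ 2) ^ 2 + (x * y) ^ 2"
    using assms(4) unfolding z'_def power2_abs by algebra
  have odd: "odd x" "odd y"
    using quartic_one_even [of x y z] quartic_one_even [of y x z] assms
    by (auto simp: coprime_commute algebra_simps)
  have "x = y"
  proof (rule ccontr)
    assume "x \<noteq> y"
    define d where "d = \<bar>x ^ 2 - y ^ 2\<bar>"
    have "x ^ 2 \<noteq> y ^ 2" using xy \<open>x \<noteq> y\<close> by (simp add: power2_eq_iff)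
    then have "d > 0" by (simp add: d_def)
    have "4 dvd x ^ 2 - y ^ 2"
      using odd_square_mod_8 [OF odd(1)] odd_square_mod_8 [OF odd(2)] by presburger
    then have "4 dvd d" by (simp add: d_def)
    then obtain w where w: "d = 2 * (2 * w)" by (auto elim!: dvdE)
    have eqd: "z' ^ 2 = d ^ 2 + (x * y) ^ 2" using eq by (simp add: d_def)
    have "odd (d ^ 2 + (x * y) ^ 2)" using odd w by simp
    then have "odd z'" using eqd by (metis even_power zero_less_numeral)
    then have "even (z' - x * y)" "even (z' + x * y)" using odd by simp_all
    then obtain M N where M: "z' - x * y = 2 * M" and N: "z' + x * y = 2 * N" by (elim evenE)
    have "4 * (M * N) = 4 * (2 * w) ^ 2" using eqd M N unfolding w by algebra
    then have MN: "M * N = (2 * w) ^ 2" by simp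
    have "2 * w > 0" using \<open>d > 0\<close> w by simp
    then have "M * N > 0" unfolding MN by simp
    moreover have "M + N \<ge> 0" using M N by (simp add: z'_def)
    ultimately have pos: "M > 0" "N > 0"
      by (auto simp: zero_less_mult_iff)
    obtain q p where *: "q > 0" "p > 0" "coprime q p" "2 * w = q * p" "M = q ^ 2" "N = p ^ 2"
    proof (rule coprime_power_factors_int [OF MN _ pos \<open>2 * w > 0\<close>])
      fix p assume p: "prime p" "p dvd 2 * w" "p dvd M" "p dvd N"
      then have "p dvd N - M" by simp
      moreover have "N - M = x * y" using M N by simp
      ultimately have "p dvd x \<or> p dvd y" using p by (simp add: prime_dvd_mult_iff)
      moreover have "p dvd d" unfolding w using p(2) by (rule dvd_mult)
      then have "p dvd x ^ 2 - y ^ 2" by (simp add: d_def)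
      then have "p dvd x ^ 2 \<longleftrightarrow> p dvd y ^ 2" by (metis dvd_diff_right_iff dvd_diff_left_iff)
      then have "p dvd x \<longleftrightarrow> p dvd y" using p by (simp add: prime_dvd_power_iff)
      ultimately show False using coprime_no_prime [OF xy(3) p(1)] by blast
    qed auto
    have "even (x ^ 2 + y ^ 2)" using odd by simp
    then obtain r where r: "x ^ 2 + y ^ 2 = 2 * r" by (elim evenE)
    have "p ^ 2 - q ^ 2 = x * y" using M N * by simp
    moreover have "4 * (p * q) ^ 2 = (x ^ 2 - y ^ 2) ^ 2"
    proof -
      have "4 * (p * q) ^ 2 = d ^ 2" using w *(4) by algebra
      then show ?thesis by (simp add: d_def)
    qed
    ultimately have "4 * r ^ 2 = 4 * (p ^ 4 - p ^ 2 * q ^ 2 + q ^ 4)" using r by algebra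
    then have r2: "r ^ 2 = p ^ 4 - p ^ 2 * q ^ 2 + q ^ 4" by simp
    have "even (q * p)" using *(4) by (metis dvd_triv_left)
    then have "even q \<or> even p" by simp
    then show False
      using quartic_one_even [of p q r] quartic_one_even [of q p r] r2 *
      by (auto simp: coprime_commute algebra_simps)
  qed
  then show ?thesis
    using xy by simp
qed

section \<open>The 2-adic valuation\<close>

text \<open>At 0 the value is 0 instead of infinity, which is why the estimates for sums carry
  alternatives such as \<open>x = 0\<close>.\<close>

definition v2 :: "rat \<Rightarrow> int" where
  "v2 r = int (multiplicity 2 (fst (quotient_of r))) - int (multiplicity 2 (snd (quotient_of r)))"

lemma multiplicity2_mult:
  "x \<noteq> 0 \<Longrightarrow> y \<noteq> 0 \<Longrightarrow> multiplicity 2 (x * y :: int) = multiplicity 2 x + multiplicity 2 y"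
  by (rule prime_elem_multiplicity_mult_distrib) auto

lemma v2_divide:
  assumes "a \<noteq> 0" "b \<noteq> 0"
  shows "v2 (of_int a / of_int b) = int (multiplicity 2 a) - int (multiplicity 2 b)"
proof -
  obtain p q where pq: "quotient_of (of_int a / of_int b) = (p, q)"
    by fastforce
  then have "q > 0" and eq: "of_int a / of_int b = (of_int p / of_int q :: rat)"
    by (simp_all add: quotient_of_denom_pos quotient_of_div)
  have "p \<noteq> 0"
    using eq assms by auto
  have "of_int (a * q) = (of_int (p * b) :: rat)"
    using eq assms \<open>q > 0\<close> by (simp add: field_simps)
  then have "a * q = p * b"
    by (simp only: of_int_eq_iff)
  then have "multiplicity 2 (a * q) = multiplicity 2 (p * b)"
    by simp
  then have "multiplicity 2 a + multiplicity 2 q = multiplicity 2 p + multiplicity 2 b"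
    using assms \<open>p \<noteq> 0\<close> \<open>q > 0\<close> by (simp add: multiplicity2_mult)
  then show ?thesis
    unfolding v2_def pq by simp
qed

lemma common_denominator:
  fixes x y :: rat
  obtains a b d :: int where "d > 0" "x = of_int a / of_int d" "y = of_int b / of_int d"
proof -
  obtain p q where pq: "quotient_of x = (p, q)" by fastforce
  obtain r s where rs: "quotient_of y = (r, s)" by fastforce
  have *: "q > 0" "s > 0" "x = of_int p / of_int q" "y = of_int r / of_int s"
    using pq rs by (simp_all add: quotient_of_denom_pos quotient_of_div)
  show ?thesis
    by (rule that [of "q * s" "p * s" "r * q"]) (use * in auto)
qed

lemma v2_mult:
  assumes "x \<noteq> 0" "y \<noteq> 0" shows "v2 (x * y) = v2 x + v2 y"
proof -
  obtain a b d :: int where *: "d > 0" "x = of_int a / of_int d" "y = of_int b / of_int d"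
    by (rule common_denominator)
  then have xy: "x * y = of_int (a * b) / of_int (d * d)" and nz: "a \<noteq> 0" "b \<noteq> 0"
    using assms by auto
  have "v2 (x * y) = int (multiplicity 2 (a * b)) - int (multiplicity 2 (d * d))"
    unfolding xy using * nz by (intro v2_divide) auto
  then show ?thesis
    using * nz by (simp add: v2_divide multiplicity2_mult)
qed

lemma v2_simps [simp]: "v2 1 = 0" "v2 2 = 1" "v2 (- x) = v2 x"
proof -
  show "v2 1 = 0" using v2_divide [of 1 1] by simp
  show "v2 2 = 1" using v2_divide [of 2 1] by simp
  have "v2 (- 1) = 0"
    using v2_mult [of "- 1" "- 1"] \<open>v2 1 = 0\<close> by simp
  then show "v2 (- x) = v2 x"
    using v2_mult [of "- 1" x] by (cases "x = 0") simp_all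
qed

lemma v2_power: "x \<noteq> 0 \<Longrightarrow> v2 (x ^ n) = int n * v2 x"
  by (induction n) (simp_all add: v2_mult algebra_simps)

lemma v2_quotient: "x \<noteq> 0 \<Longrightarrow> y \<noteq> 0 \<Longrightarrow> v2 (x / y) = v2 x - v2 y"
  using v2_mult [of "x / y" y] by simp

lemma v2_add_ge:
  assumes "x + y \<noteq> 0" "x = 0 \<or> k \<le> v2 x" "y = 0 \<or> k \<le> v2 y"
  shows "k \<le> v2 (x + y)"
proof (cases "x = 0 \<or> y = 0")
  case False
  obtain a b d :: int where *: "d > 0" "x = of_int a / of_int d" "y = of_int b / of_int d"
    by (rule common_denominator)
  then have xy: "x + y = of_int (a + b) / of_int d"
    by (simp add: add_divide_distrib)
  then have nz: "a \<noteq> 0" "b \<noteq> 0" "a + b \<noteq> 0"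
    using False assms(1) * by (auto simp del: of_int_add)
  \<comment> \<open>After clearing the denominator the bound \<open>k\<close> becomes divisibility
    by 2^j. A negative exponent is truncated to 0, where divisibility is trivial.\<close>
  define j where "j = nat (k + int (multiplicity 2 d))"
  have v: "v2 x = int (multiplicity 2 a) - int (multiplicity 2 d)"
    "v2 y = int (multiplicity 2 b) - int (multiplicity 2 d)"
    "v2 (x + y) = int (multiplicity 2 (a + b)) - int (multiplicity 2 d)"
    unfolding xy unfolding * using nz \<open>d > 0\<close> by (intro v2_divide; simp)+
  then have "j \<le> multiplicity 2 a" "j \<le> multiplicity 2 b"
    using assms False unfolding j_def by linarith+
  then have "2 ^ j dvd a + b"
    by (intro dvd_add multiplicity_dvd')
  then have "j \<le> multiplicity 2 (a + b)"
    using nz by (intro multiplicity_geI) auto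
  then show ?thesis
    using v unfolding j_def by linarith
qed (use assms in auto)

lemma v2_add_ge':
  assumes "x = 0 \<or> k \<le> v2 x" "y = 0 \<or> k \<le> v2 y"
  shows "x + y = 0 \<or> k \<le> v2 (x + y)"
  using v2_add_ge assms by blast

lemma v2_add_dominant:
  assumes "x \<noteq> 0" "y = 0 \<or> v2 x < v2 y"
  shows "x + y \<noteq> 0" "v2 (x + y) = v2 x"
proof -
  show nz: "x + y \<noteq> 0"
  proof
    assume "x + y = 0"
    then have "y = - x" by (simp add: eq_neg_iff_add_eq_0 add.commute)
    then show False using assms by auto
  qed
  have "v2 x \<le> v2 (x + y)"
    using assms by (intro v2_add_ge nz) auto
  moreover have "v2 (x + y) \<le> v2 x"
  proof (rule ccontr)
    assume *: "\<not> v2 (x + y) \<le> v2 x"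
    have "v2 x + 1 \<le> v2 ((x + y) + (- y))"
      using assms * by (intro v2_add_ge) auto
    then show False by simp
  qed
  ultimately show "v2 (x + y) = v2 x" by simp
qed

lemma v2_eq_0_odd:
  assumes "x \<noteq> 0" "v2 x = 0"
  obtains a b where "odd a" "odd b" "x = of_int a / of_int b"
proof -
  obtain a b where ab: "quotient_of x = (a, b)" by fastforce
  then have *: "b > 0" "x = of_int a / of_int b" "coprime a b"
    by (simp_all add: quotient_of_denom_pos quotient_of_div quotient_of_coprime)
  have "a \<noteq> 0" using * assms by auto
  have m: "multiplicity 2 a = multiplicity 2 b"
    using assms by (simp add: v2_def ab)
  then have "even a \<longleftrightarrow> even b"
    using \<open>a \<noteq> 0\<close> \<open>b > 0\<close> by (metis multiplicity_eq_zero_iff not_dvd_imp_multiplicity_0 less_int_code(1)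
        prime_multiplicity_gt_zero_iff prime_imp_prime_elem two_is_prime_nat neq0_conv
        multiplicity_gt_zero_iff not_prime_unit odd_one)
  then have "odd a" "odd b"
    using * coprime_common_divisor [of a b 2] by auto
  then show ?thesis using that * by blast
qed

text \<open>The residue field at 2 has two elements, so two units always cancel in it: odd plus odd
  is even.\<close>

lemma v2_units_add:
  assumes "x \<noteq> 0" "y \<noteq> 0" "v2 x = 0" "v2 y = 0" "x + y \<noteq> 0"
  shows "1 \<le> v2 (x + y)"
proof -
  obtain a b where ab: "odd a" "odd b" "x = of_int a / of_int b"
    using v2_eq_0_odd assms by metis
  obtain c d where cd: "odd c" "odd d" "y = of_int c / of_int d"
    using v2_eq_0_odd assms by metis
  have nz: "b \<noteq> 0" "d \<noteq> 0" using ab cd by auto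
  have xy: "x + y = of_int (a * d + c * b) / of_int (b * d)"
    using nz by (simp add: ab cd add_frac_eq)
  have nz': "a * d + c * b \<noteq> 0" "b * d \<noteq> 0"
    using xy nz assms(5) by (auto simp del: of_int_add of_int_mult)
  have "2 ^ 1 dvd a * d + c * b" using ab cd by simp
  then have "1 \<le> multiplicity 2 (a * d + c * b)"
    using nz' by (intro multiplicity_geI) auto
  moreover have "multiplicity 2 (b * d) = 0"
    using ab cd by (intro not_dvd_imp_multiplicity_0) simp
  ultimately show ?thesis
    unfolding xy v2_divide [OF nz'] by simp
qed

lemma rat_square_int:
  fixes r :: rat
  assumes "r ^ 2 = of_int k"
  obtains z where "r = of_int z" "z ^ 2 = k"
proof -
  obtain p q where pq: "quotient_of r = (p, q)" by fastforce
  then have *: "q > 0" "r = of_int p / of_int q" "coprime p q"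
    by (simp_all add: quotient_of_denom_pos quotient_of_div quotient_of_coprime)
  have "of_int (p ^ 2) = (of_int (k * q ^ 2) :: rat)"
    using assms * by (simp add: field_simps)
  then have "p ^ 2 = k * q ^ 2" by (simp only: of_int_eq_iff)
  then have "q ^ 2 dvd p ^ 2" by simp
  moreover have "coprime (p ^ 2) (q ^ 2)" using * by simp
  ultimately have "is_unit (q ^ 2)"
    by (metis coprime_absorb_right coprime_commute)
  then have "q = 1" using *(1) by (auto simp: power2_eq_1_iff)
  then have "r = of_int p" using * by simp
  moreover from this have "p ^ 2 = k" using assms by (metis of_int_eq_iff of_int_power)
  ultimately show ?thesis using that by blast
qed

section \<open>Torsion and rank\<close>

context group
begin

definition torsion :: "'a \<Rightarrow> bool" where
  "torsion x \<longleftrightarrow> x \<in> carrier G \<and> (\<exists>n::nat. n > 0 \<and> x [^] n = \<one>)"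

lemma torsionI: "x \<in> carrier G \<Longrightarrow> (n::nat) > 0 \<Longrightarrow> x [^] n = \<one> \<Longrightarrow> torsion x"
  by (auto simp: torsion_def)

lemma torsion_nat_pow: "torsion x \<Longrightarrow> torsion (x [^] (k::nat))"
  unfolding torsion_def by (metis mult.commute nat_pow_closed nat_pow_one nat_pow_pow)

lemma torsion_nat_powD:
  assumes "x \<in> carrier G" "(k::nat) > 0" "torsion (x [^] k)" shows "torsion x"
proof -
  obtain n :: nat where "n > 0" "(x [^] k) [^] n = \<one>"
    using assms(3) by (auto simp: torsion_def)
  then show ?thesis
    using assms by (intro torsionI [of _ "k * n"]) (simp_all add: nat_pow_pow)
qed

text \<open>The powers of a torsion element form a finite set. Only exponents 2^j are tested because
  valuations are controlled along repeated doubling.\<close>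

lemma not_torsion_if_doublings_distinct:
  assumes x: "x \<in> carrier G" and inj: "inj (\<lambda>j::nat. x [^] (2 ^ j :: nat))"
  shows "\<not> torsion x"
proof
  assume "torsion x"
  then obtain n :: nat where n: "n > 0" "x [^] n = \<one>"
    by (auto simp: torsion_def)
  have "x [^] k = x [^] (k mod n)" for k :: nat
  proof -
    have "x [^] k = x [^] (n * (k div n) + k mod n)"
      by simp
    also have "\<dots> = (x [^] n) [^] (k div n) \<otimes> x [^] (k mod n)"
      using x by (simp only: nat_pow_mult [symmetric] nat_pow_pow)
    also have "\<dots> = x [^] (k mod n)"
      using x n by simp
    finally show ?thesis .
  qed
  then have "range (\<lambda>j::nat. x [^] (2 ^ j :: nat)) \<subseteq> (\<lambda>k. x [^] k) ` {..<n}"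
    using n(1) by (intro image_subsetI image_eqI [of _ _ "2 ^ j mod n" for j]) auto
  then have "finite (range (\<lambda>j::nat. x [^] (2 ^ j :: nat)))"
    using finite_surj by blast
  then show False
    using inj finite_imageD infinite_UNIV_nat by blast
qed

lemma int_pow_eq_one_torsion:
  assumes "x \<in> carrier G" "x [^] (n::int) = \<one>" "n \<noteq> 0" shows "torsion x"
proof (cases "n > 0")
  case True
  then have "x [^] int (nat n) = \<one>"
    using assms(2) by simp
  then have "x [^] nat n = \<one>"
    by (simp only: int_pow_int)
  with True assms(1) show ?thesis
    by (intro torsionI [of _ "nat n"]) auto
next
  case False
  with assms(3) have "n < 0"
    by simp
  then have "x [^] (- int (nat (- n))) = \<one>"
    using assms(2) by simp
  then have "inv (x [^] nat (- n)) = \<one>"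
    by (simp only: int_pow_neg_int [OF assms(1)])
  then have "x [^] nat (- n) = \<one>"
    using inv_eq_1_iff [OF nat_pow_closed [OF assms(1)]] by blast
  with \<open>n < 0\<close> assms(1) show ?thesis
    by (intro torsionI [of _ "nat (- n)"]) auto
qed

end

context comm_group
begin

lemma group_rank_pos:
  assumes "x \<in> carrier G" "\<not> torsion x" shows "group_rank G > 0"
proof -
  have "int_independent G {x}"
    unfolding int_independent_def
  proof (intro allI impI ballI)
    fix n :: "'a \<Rightarrow> int" and y
    assume "finprod G (\<lambda>x. x [^] n x) {x} = \<one>" "y \<in> {x}"
    then show "n y = 0"
      using assms int_pow_eq_one_torsion by auto
  qed
  then have "enat (card {x}) \<le> group_rank G"
    unfolding group_rank_def using assms by (intro SUP_upper) auto
  moreover have "0 < enat (card {x})"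
    by (simp add: zero_enat_def)
  ultimately show ?thesis
    by (rule less_le_trans [rotated])
qed

text \<open>A torsion element in a set gives a nontrivial relation supported on that element alone,
  so only the empty set is independent.\<close>

lemma group_rank_zero:
  assumes "\<And>x. x \<in> carrier G \<Longrightarrow> torsion x" shows "group_rank G = 0"
proof -
  have "S = {}" if S: "finite S" "S \<subseteq> carrier G" "int_independent G S" for S
  proof (rule ccontr)
    assume "S \<noteq> {}"
    then obtain x where x: "x \<in> S" by auto
    then obtain k :: nat where k: "k > 0" "x [^] k = \<one>"
      using assms S by (auto simp: torsion_def)
    define n where "n y = (if y = x then int k else 0)" for y
    have "finprod G (\<lambda>y. y [^] n y) S = \<one>"
      using k by (intro finprod_one_eqI) (simp add: n_def int_pow_int)
    then have "n x = 0"
      using S(3) x unfolding int_independent_def by blast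
    then show False
      using k by (simp add: n_def)
  qed
  then have "group_rank G \<le> 0"
    unfolding group_rank_def by (intro SUP_least) (auto simp: zero_enat_def)
  then show ?thesis
    by simp
qed

end

section \<open>Rational points\<close>

lemma rational_point_coordinates:
  fixes t u v :: rat and T :: int
  assumes "t = of_int T" "T \<in> {-1, 1, 3}" and "v ^ 2 = u ^ 3 - t * u ^ 2 + t * u" and "u \<noteq> 0"
  shows "v \<noteq> 0" "u = 1 \<or> T = -1 \<and> u = -1 \<or> T = 3 \<and> u = 3"
proof -
  show v0: "v \<noteq> 0"
  proof
    assume "v = 0"
    then have "u * (u ^ 2 - t * u + t) = 0"
      using assms(3) by algebra
    then have "u ^ 2 - t * u + t = 0"
      using \<open>u \<noteq> 0\<close> by simp
    \<comment> \<open>The discriminant t^2 - 4 t is 5 for t = -1 and -3 otherwise, never a rational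
      square.\<close>
    then have "(2 * u - t) ^ 2 = t ^ 2 - 4 * t"
      by algebra
    also have "\<dots> = of_int (T ^ 2 - 4 * T)"
      using assms(1) by simp
    finally obtain z where z: "z ^ 2 = T ^ 2 - 4 * T"
      by (rule rat_square_int)
    have "T = -1"
      using z zero_le_power2 [of z] assms(2) by auto
    then have "z ^ 2 = 5" using z by simp
    moreover from this have "odd (z ^ 2)"
      by simp
    then have "odd z"
      by simp
    ultimately show False
      using odd_square_mod_8 [of z] by simp
  qed
  obtain m n where mn: "quotient_of u = (m, n)" by fastforce
  then have n: "n > 0" and u: "u = of_int m / of_int n" and cop: "coprime m n"
    by (simp_all add: quotient_of_denom_pos quotient_of_div quotient_of_coprime)
  have m0: "m \<noteq> 0" using u \<open>u \<noteq> 0\<close> by auto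
  define K where "K = m * (m ^ 2 - T * m * n + T * n ^ 2)"
  have "(v * of_int n ^ 2) ^ 2 = v ^ 2 * of_int n ^ 4"
    by algebra
  also have "\<dots> = of_int (n * K)"
    unfolding assms(3) u K_def using n assms(1) by (simp add: field_simps power2_eq_square power3_eq_cube power4_eq_xxxx)
  finally have sq: "(v * of_int n ^ 2) ^ 2 = of_int (n * K)" .
  then obtain z' where z': "v * of_int n ^ 2 = of_int z'" "z' ^ 2 = n * K"
    by (rule rat_square_int)
  define z where "z = \<bar>z'\<bar>"
  have "z' \<noteq> 0" using z'(1) v0 n by auto
  then have z: "z > 0" "n * K = z ^ 2" using z'(2) by (simp_all add: z_def)
  have noprime: False if "prime p" "p dvd m" "p dvd n" for p
    using coprime_no_prime [OF cop that] .
  have "n * K > 0" using z by simp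
  then have K: "K > 0" using n by (simp add: zero_less_mult_iff)
  obtain e f where ef: "e > 0" "f > 0" "coprime e f" "z = e * f" "n = e ^ 2" "K = f ^ 2"
  proof (rule coprime_power_factors_int [OF z(2) _ n K z(1)])
    fix p assume p: "prime p" "p dvd z" "p dvd n" "p dvd K"
    have "p dvd K - n * (- T * m ^ 2 + T * m * n)"
      using p by (intro dvd_diff) auto
    also have "K - n * (- T * m ^ 2 + T * m * n) = m ^ 3"
      unfolding K_def by algebra
    finally have "p dvd m" using p prime_dvd_power by blast
    then show False using noprime p by blast
  qed auto
  define L where "L = m ^ 2 - T * m * n + T * n ^ 2"
  have KL: "m * L = f ^ 2" using ef by (simp add: K_def L_def)
  then have mL: "m * L > 0" using ef by simp
  have pL: "p dvd T" if "prime p" "p dvd m" "p dvd L" for p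
  proof -
    have "p dvd L - m * (m - T * n)" using that by (intro dvd_diff) auto
    also have "L - m * (m - T * n) = T * n ^ 2" unfolding L_def by algebra
    finally have "p dvd T \<or> p dvd n ^ 2" using that by (simp add: prime_dvd_mult_iff)
    then show ?thesis using noprime that prime_dvd_power by blast
  qed
  have posL: "L > 0" if "T \<noteq> -1"
  proof -
    have "4 * L = (2 * m - T * n) ^ 2 + T * (4 - T) * n ^ 2"
      unfolding L_def by algebra
    moreover have "T * (4 - T) * n ^ 2 > 0" using assms(2) that n by auto
    ultimately show ?thesis using zero_le_power2 [of "2 * m - T * n"] by linarith
  qed
  have u1: "u = 1" if "m = 1" "e = 1" using u ef that by simp
  have quartic: "M = 1 \<and> e = 1"
    if "M > 0" "coprime M e" "N ^ 2 = M ^ 4 - T * M ^ 2 * e ^ 2 + T * e ^ 4" for M N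
    using quartic_minus_one [of M e N] quartic_one [of M e N] quartic_three [of M e N]
      that ef(1) assms(2) by auto
  have cop_e: "coprime M e" if "M dvd m" for M
  proof (rule coprime_int_primeI)
    fix p assume "prime p" "p dvd M" "p dvd e"
    then show False using noprime [of p] that ef(5) by (simp add: dvd_trans [OF _ that] power2_eq_square)
  qed
  \<comment> \<open>Common primes of \<open>m\<close> and \<open>L\<close> divide \<open>T\<close>,
    so \<open>m\<close> is a square up to sign and a factor 3. The last two cases mirror the first
    under translation by the 2-torsion point (0, 0), which sends u to t/u; accordingly the same
    quartic appears with \<open>M\<close> and \<open>e\<close> exchanged.\<close>
  consider "m > 0" "T \<in> {-1, 1} \<or> \<not> 3 dvd m" | "m < 0" "T = -1" | "m > 0" "T = 3" "3 dvd m"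
    using m0 assms(2) posL mL by (force simp: zero_less_mult_iff)
  then show "u = 1 \<or> T = -1 \<and> u = -1 \<or> T = 3 \<and> u = 3"
  proof cases
    case 1
    have "L > 0" using mL 1 by (simp add: zero_less_mult_iff)
    obtain M N where M: "M > 0" "N > 0" "f = M * N" "m = M ^ 2" "L = N ^ 2"
    proof (rule coprime_power_factors_int [OF KL _ \<open>m > 0\<close> \<open>L > 0\<close> ef(2)])
      fix p assume p: "prime p" "p dvd f" "p dvd m" "p dvd L"
      then have pT: "p dvd T" using pL by blast
      then have "T = 3" using p(1) assms(2) by auto
      then have "p = 3" using pT p(1) by (simp add: primes_dvd_imp_eq)
      then show False using 1 p \<open>T = 3\<close> by simp
    qed auto
    have "N ^ 2 = M ^ 4 - T * M ^ 2 * e ^ 2 + T * e ^ 4"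
      unfolding M(5) [symmetric] L_def M(4) ef(5) by algebra
    moreover have "coprime M e" using cop_e M by simp
    ultimately have "M = 1 \<and> e = 1" using quartic M by blast
    then show ?thesis using u1 M by simp
  next
    case 2
    have "- L > 0" using mL 2 by (simp add: zero_less_mult_iff)
    have KL': "(- m) * (- L) = f ^ 2" using KL by simp
    have "- m > 0" using 2 by simp
    obtain M N where M: "M > 0" "N > 0" "f = M * N" "- m = M ^ 2" "- L = N ^ 2"
    proof (rule coprime_power_factors_int [OF KL' _ \<open>- m > 0\<close> \<open>- L > 0\<close> ef(2)])
      fix p assume p: "prime p" "p dvd f" "p dvd - m" "p dvd - L"
      then have "p dvd T" using pL by simp
      then have "is_unit p" using 2 by simp
      then show False using p(1) not_prime_unit by blast
    qed auto
    have m: "m = - (M ^ 2)" using M by simp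
    have "N ^ 2 = e ^ 4 + e ^ 2 * M ^ 2 - M ^ 4"
      unfolding M(5) [symmetric] L_def m ef(5) 2(2) by algebra
    moreover have "coprime e M" using cop_e [of M] m by (simp add: coprime_commute)
    ultimately have "e = 1 \<and> M = 1" using quartic_minus_one M ef by blast
    then show ?thesis using u ef m 2 by simp
  next
    case 3
    then obtain k where k: "m = 3 * k" by auto
    define L' where "L' = 3 * k ^ 2 - 3 * k * n + n ^ 2"
    have L': "L = 3 * L'" unfolding L_def L'_def k 3(2) by algebra
    have "3 dvd f ^ 2" using KL k by (metis dvd_mult2 dvd_triv_left)
    then have "3 dvd f" by (rule prime_dvd_power [rotated]) simp
    then obtain f' where f': "f = 3 * f'" ..
    have "9 * (k * L') = 9 * f' ^ 2" using KL unfolding k L' f' by algebra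
    then have KL': "k * L' = f' ^ 2" by simp
    have pos: "k > 0" "f' > 0" "L' > 0" using 3 k f' ef mL L' by (simp_all add: zero_less_mult_iff)
    obtain M N where M: "M > 0" "N > 0" "f' = M * N" "k = M ^ 2" "L' = N ^ 2"
    proof (rule coprime_power_factors_int [OF KL' _ \<open>k > 0\<close> \<open>L' > 0\<close> pos(2)])
      fix p assume p: "prime p" "p dvd f'" "p dvd k" "p dvd L'"
      have "p dvd L' - k * (3 * k - 3 * n)" using p by (intro dvd_diff) auto
      also have "L' - k * (3 * k - 3 * n) = n ^ 2" unfolding L'_def by algebra
      finally have "p dvd n" using p prime_dvd_power by blast
      then show False using noprime [of p] p k by simp
    qed auto
    have "N ^ 2 = e ^ 4 - 3 * e ^ 2 * M ^ 2 + 3 * M ^ 4"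
      unfolding M(5) [symmetric] L'_def M(4) ef(5) by algebra
    moreover have "coprime e M" using cop_e [of M] M k by (simp add: coprime_commute)
    ultimately have "e = 1 \<and> M = 1" using quartic_three M ef by blast
    then show ?thesis using u ef k M 3 by simp
  qed
qed

section \<open>The model with parameters p and t, its torsion, and doubling near infinity\<close>

locale E1_model =
  fixes p t :: rat
  assumes p: "p \<noteq> 0" and t: "t \<noteq> 0" "t \<noteq> 4"
begin

text \<open>\<open>p\<close> stands for a c and \<open>t\<close> for b^2 / (a c). Substituting b^2 =
  t p in the coefficients of the given curve yields \<open>A\<close> and \<open>B\<close>; the
  locale assumptions say that the discriminant does not vanish.\<close>

definition A where "A = 27 * p ^ 4 * t * (3 - t)"
definition B where "B = 27 * p ^ 6 * t ^ 2 * (9 - 2 * t)"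

lemma elliptic: "elliptic_curve A B"
proof -
  have "4 * A ^ 3 + 27 * B ^ 2 = 3 ^ 12 * p ^ 12 * t ^ 3 * (4 - t)"
    unfolding A_def B_def by algebra
  then show ?thesis
    using p t by (simp add: elliptic_curve_def)
qed

sublocale comm_group "ec_group A B"
  by (rule comm_group_ec_group [OF elliptic])

text \<open>The curve is isomorphic to \<open>v\<^sup>2 = u\<^sup>3 - t u\<^sup>2 + t u\<close>, which contains \<open>(1, 1)\<close>.\<close>

definition pt :: "rat \<Rightarrow> rat \<Rightarrow> rat ec_point" where
  "pt u v = Affine (p ^ 2 * (9 * u - 3 * t)) (27 * p ^ 3 * v)"

lemma pt_inject [simp]: "pt u v = pt u' v' \<longleftrightarrow> u = u' \<and> v = v'"
  using p by (auto simp: pt_def)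

lemma on_curve_pt [simp]: "on_curve A B (pt u v) \<longleftrightarrow> v ^ 2 = u ^ 3 - t * u ^ 2 + t * u"
proof -
  have "(27 * p ^ 3 * v) ^ 2 - ((p ^ 2 * (9 * u - 3 * t)) ^ 3 + A * (p ^ 2 * (9 * u - 3 * t)) + B)
      = 729 * p ^ 6 * (v ^ 2 - (u ^ 3 - t * u ^ 2 + t * u))"
    unfolding A_def B_def by algebra
  then show ?thesis
    using p unfolding pt_def on_curve.simps by (metis eq_iff_diff_eq_0 mult_eq_0_iff power_not_zero zero_neq_numeral)
qed

lemma affine_eq_pt: "\<exists>u v. Affine x y = pt u v"
  by (rule exI [of _ "(x / p ^ 2 + 3 * t) / 9"], rule exI [of _ "y / (27 * p ^ 3)"])
    (use p in \<open>simp add: pt_def field_simps\<close>)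

lemma pt_double:
  assumes "v \<noteq> 0" "m * (2 * v) = 3 * u ^ 2 - 2 * t * u + t"
  shows "ec_add A (pt u v) (pt u v) = pt (m ^ 2 + t - 2 * u) (m * (u - (m ^ 2 + t - 2 * u)) - v)"
proof -
  have 1: "27 * p ^ 3 * v \<noteq> 0"
    using assms p by simp
  \<comment> \<open>The coordinate change is X = (3 p)^2 (u - t/3), Y = (3 p)^3 v: the shift removes
    the quadratic term, and slopes are multiplied by 3 p.\<close>
  have 2: "(3 * p * m) * (2 * (27 * p ^ 3 * v)) = 3 * (p ^ 2 * (9 * u - 3 * t)) ^ 2 + A"
    using assms(2) unfolding A_def by algebra
  show ?thesis
    unfolding pt_def ec_add_tangent [OF 1 2] ec_point.inject by (intro conjI; algebra)
qed

lemma pt_chord: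
  assumes "u1 \<noteq> u2" "m * (u2 - u1) = w2 - w1"
  shows "\<exists>w. ec_add A (pt u1 w1) (pt u2 w2) = pt (m ^ 2 + t - u1 - u2) w"
proof -
  have 1: "(3 * p * m) * (p ^ 2 * (9 * u2 - 3 * t) - p ^ 2 * (9 * u1 - 3 * t))
      = 27 * p ^ 3 * w2 - 27 * p ^ 3 * w1"
    using assms(2) by algebra
  have 2: "p ^ 2 * (9 * u1 - 3 * t) \<noteq> p ^ 2 * (9 * u2 - 3 * t)"
    using assms p by simp
  show ?thesis
    unfolding pt_def ec_add_chord [OF 2 1] ec_point.inject
    by (intro exI [of _ "m * (u1 - (m ^ 2 + t - u1 - u2)) - w1"] conjI; algebra)
qed

text \<open>The duplication formula for a cubic with the 2-torsion point (0, 0). Written as a square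
  of a quotient, its valuation can be read off, which the sum m^2 + t - 2 u would not allow because
  of cancellation.\<close>

lemma pt_double_x:
  assumes "v \<noteq> 0" "v ^ 2 = u ^ 3 - t * u ^ 2 + t * u"
  shows "\<exists>v'. ec_add A (pt u v) (pt u v) = pt (((u ^ 2 - t) / (2 * v)) ^ 2) v'"
proof -
  define m where "m = (3 * u ^ 2 - 2 * t * u + t) / (2 * v)"
  have m: "m * (2 * v) = 3 * u ^ 2 - 2 * t * u + t"
    using assms by (simp add: m_def)
  have "(m ^ 2 + t - 2 * u) * (2 * v) ^ 2 = (u ^ 2 - t) ^ 2"
    using m assms(2) by algebra
  then have "m ^ 2 + t - 2 * u = ((u ^ 2 - t) / (2 * v)) ^ 2"
    using assms(1) by (simp add: power_divide eq_divide_eq)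
  then show ?thesis
    using pt_double [OF assms(1) m] by auto
qed

lemma carrier_cases:
  assumes "P \<in> carrier (ec_group A B)"
  obtains "P = Infinity" | u v where "P = pt u v" "v ^ 2 = u ^ 3 - t * u ^ 2 + t * u"
  using assms affine_eq_pt on_curve_pt by (cases P) (simp, metis ec_group_simps(1) mem_Collect_eq)

lemma pow2: "x \<in> carrier (ec_group A B) \<Longrightarrow> x [^]\<^bsub>ec_group A B\<^esub> (2::nat) = ec_add A x x"
  by (simp add: numeral_2_eq_2)

text \<open>Points with u = 0 have order 2. A point with u = 1 doubles to (0, 0) if t = 1 and to its
  own negative if t is -1 or 3. The remaining points, with u = -1 or u = 3, double to points with u
  = 1.\<close>

lemma torsion_all:
  assumes T: "t = of_int T" "T \<in> {-1, 1, 3}" and P: "P \<in> carrier (ec_group A B)"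
  shows "torsion P"
proof -
  have double: "torsion Q" if "Q \<in> carrier (ec_group A B)" "torsion (ec_add A Q Q)" for Q
    using torsion_nat_powD [of Q 2] that by (simp add: pow2)
  have tors0: "torsion Infinity"
    using torsionI [of Infinity 1] by simp
  have tors_u0: "torsion (pt 0 v)" if "v ^ 2 = 0 ^ 3 - t * 0 ^ 2 + t * 0" for v
  proof (rule double)
    show "torsion (ec_add A (pt 0 v) (pt 0 v))"
      using that tors0 by (simp add: pt_def)
  qed (use that in simp)
  have tors_u1: "torsion (pt 1 v)" if v: "v ^ 2 = 1 ^ 3 - t * 1 ^ 2 + t * 1" for v
  proof -
    have v1: "v ^ 2 = 1" "v \<noteq> 0" using v by auto
    have on: "pt 1 v \<in> carrier (ec_group A B)" using v by simp
    obtain v' where d: "ec_add A (pt 1 v) (pt 1 v) = pt (((1 ^ 2 - t) / (2 * v)) ^ 2) v'"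
      using pt_double_x [OF v1(2) v] by blast
    have on': "on_curve A B (pt (((1 ^ 2 - t) / (2 * v)) ^ 2) v')"
      using on_curve_ec_add [of A B "pt 1 v" "pt 1 v"] v unfolding d by simp
    show ?thesis
    proof (cases "T = 1")
      case True
      then have "((1 ^ 2 - t) / (2 * v)) ^ 2 = 0"
        using T by simp
      then have d0: "ec_add A (pt 1 v) (pt 1 v) = pt 0 v'" and "on_curve A B (pt 0 v')"
        using d on' by (simp_all only:)
      then have "torsion (pt 0 v')"
        using tors_u0 by simp
      then show ?thesis
        using double [OF on] d0 by simp
    next
      case False
      then have "((1 ^ 2 - t) / (2 * v)) ^ 2 = 1"
        using T v1 by (auto simp: power_divide power_mult_distrib)
      then have d1: "ec_add A (pt 1 v) (pt 1 v) = pt 1 v'" and "v' ^ 2 = v ^ 2"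
        using d on' v1 by simp_all
      then have "v' = v \<or> v' = - v" by (simp add: power2_eq_iff)
      then show ?thesis
      proof
        assume "v' = v"
        then have "pt 1 v \<otimes>\<^bsub>ec_group A B\<^esub> pt 1 v = pt 1 v"
          using d1 by simp
        then have "pt 1 v = \<one>\<^bsub>ec_group A B\<^esub>"
          using l_cancel_one [OF on on] by blast
        then show ?thesis by (simp add: pt_def)
      next
        assume "v' = - v"
        then have "ec_add A (ec_add A (pt 1 v) (pt 1 v)) (pt 1 v) = Infinity"
          using d1 by (simp add: pt_def)
        then show ?thesis
          using on by (intro torsionI [of _ 3]) (simp_all add: numeral_3_eq_3)
      qed
    qed
  qed
  from P show ?thesis
  proof (cases rule: carrier_cases)
    case 1
    then show ?thesis using tors0 by simp
  next
    case (2 u v)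
    show ?thesis
    proof (cases "u = 0 \<or> u = 1")
      case True
      then show ?thesis using 2 tors_u0 [of v] tors_u1 [of v] by auto
    next
      case False
      then have v0: "v \<noteq> 0" and u: "T = -1 \<and> u = -1 \<or> T = 3 \<and> u = 3"
        using rational_point_coordinates [OF T 2(2)] by auto
      obtain v' where d: "ec_add A (pt u v) (pt u v) = pt (((u ^ 2 - t) / (2 * v)) ^ 2) v'"
        using pt_double_x [OF v0 2(2)] by blast
      have on': "on_curve A B (pt (((u ^ 2 - t) / (2 * v)) ^ 2) v')"
        using on_curve_ec_add [of A B "pt u v" "pt u v"] 2 unfolding d by simp
      have "((u ^ 2 - t) / (2 * v)) ^ 2 = 1"
        using u T(1) 2(2) by (auto simp: power_divide power_mult_distrib)
      then have "torsion (ec_add A (pt u v) (pt u v))"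
        using d on' tors_u1 [of v'] by simp
      then show ?thesis
        using double [of P] P unfolding 2 by blast
    qed
  qed
qed

text \<open>
  Points with such \<open>u\<close> are 2-adically close to infinity, and doubling lowers the valuation of \<open>u\<close>
  by 2.
\<close>

definition near_infinity :: "rat \<Rightarrow> bool" where
  "near_infinity u \<longleftrightarrow> u \<noteq> 0 \<and> v2 u < 0 \<and> v2 u < v2 t"

lemma near_infinity_double:
  assumes "near_infinity u" "v ^ 2 = u ^ 3 - t * u ^ 2 + t * u"
  shows "\<exists>u' v'. ec_add A (pt u v) (pt u v) = pt u' v' \<and> near_infinity u' \<and> v2 u' = v2 u - 2"
proof -
  have u: "u \<noteq> 0" "v2 u < 0" "v2 u < v2 t"
    using assms(1) by (auto simp: near_infinity_def)
  \<comment> \<open>As \<open>v2 u\<close> is negative and below \<open>v2 t\<close>, 2 v2(u) is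
    below both v2(t) and v2(t u). So u^2 dominates here and in the cofactor of u in v^2.\<close>
  have n: "u ^ 2 + - t \<noteq> 0" "v2 (u ^ 2 + - t) = 2 * v2 u"
    using v2_add_dominant [of "u ^ 2" "- t"] u by (simp_all add: v2_power)
  have "- (t * u) + t = 0 \<or> 2 * v2 u + 1 \<le> v2 (- (t * u) + t)"
    using u t by (intro v2_add_ge') (auto simp: v2_mult)
  then have w: "- (t * u) + t = 0 \<or> 2 * v2 u < v2 (- (t * u) + t)"
    by linarith
  have d: "u ^ 2 + (- (t * u) + t) \<noteq> 0" "v2 (u ^ 2 + (- (t * u) + t)) = 2 * v2 u"
    using v2_add_dominant [of "u ^ 2" "- (t * u) + t"] u w by (simp_all add: v2_power)
  have v: "v ^ 2 = u * (u ^ 2 + (- (t * u) + t))"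
    using assms(2) by algebra
  then have v0: "v \<noteq> 0"
    using u d by auto
  have "v2 (v ^ 2) = 3 * v2 u"
    unfolding v using u d by (simp add: v2_mult)
  then have vv: "2 * v2 v = 3 * v2 u"
    using v0 by (simp add: v2_power)
  \<comment> \<open>With 2 v2(v) = 3 v2(u), the new valuation is 2 (2 v2(u) - 1 - v2(v)) = v2(u) -
    2; the drop comes from the 2 in the denominator.\<close>
  define u' where "u' = ((u ^ 2 - t) / (2 * v)) ^ 2"
  have "u' \<noteq> 0"
    using n v0 by (simp add: u'_def)
  moreover have "v2 u' = v2 u - 2"
    using n v0 vv by (simp add: u'_def v2_power v2_quotient v2_mult)
  ultimately show ?thesis
    using pt_double_x [OF v0 assms(2)] u unfolding u'_def [symmetric] near_infinity_def by fastforce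
qed

lemma near_infinity_not_torsion:
  assumes u: "near_infinity u" and v: "v ^ 2 = u ^ 3 - t * u ^ 2 + t * u"
  shows "\<not> torsion (pt u v)"
proof (rule not_torsion_if_doublings_distinct)
  let ?P = "pt u v"
  show on: "?P \<in> carrier (ec_group A B)"
    using v by simp
  have *: "\<exists>u' v'. ?P [^]\<^bsub>ec_group A B\<^esub> (2 ^ j :: nat) = pt u' v' \<and> near_infinity u' \<and> v2 u' = v2 u - 2 * int j" for j
  proof (induction j)
    case 0
    then show ?case using u on by auto
  next
    case (Suc j)
    then obtain u' v' where IH: "?P [^]\<^bsub>ec_group A B\<^esub> (2 ^ j :: nat) = pt u' v'"
      "near_infinity u'" "v2 u' = v2 u - 2 * int j" by blast
    have "pt u' v' \<in> carrier (ec_group A B)"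
      unfolding IH(1) [symmetric] using on by (rule nat_pow_closed)
    then have v': "v' ^ 2 = u' ^ 3 - t * u' ^ 2 + t * u'" by simp
    have "?P [^]\<^bsub>ec_group A B\<^esub> (2 ^ Suc j :: nat) = ec_add A (pt u' v') (pt u' v')"
      using nat_pow_mult [OF on, of "2 ^ j" "2 ^ j"] IH(1) by (simp add: mult_2)
    then show ?case
      using near_infinity_double [OF IH(2) v'] IH(3) by auto
  qed
  show "inj (\<lambda>j::nat. ?P [^]\<^bsub>ec_group A B\<^esub> (2 ^ j :: nat))"
  proof (rule injI)
    fix i j :: nat
    assume "?P [^]\<^bsub>ec_group A B\<^esub> (2 ^ i :: nat) = ?P [^]\<^bsub>ec_group A B\<^esub> (2 ^ j :: nat)"
    then show "i = j"
      using * [of i] * [of j] by auto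
  qed
qed

lemma base_point_not_torsion:
  assumes "t \<notin> {-1, 1, 3}"
  shows "\<not> torsion (pt 1 1)"
proof
  assume tors: "torsion (pt 1 1)"
  let ?P = "pt 1 1"
  have on: "?P \<in> carrier (ec_group A B)"
    by simp
  define s where "s = (t - 1) / 2"
  have "2 * s = t - 1"
    by (simp add: s_def)
  then have ts: "t = 2 * s + 1"
    by simp
  have s: "s \<noteq> 0" "s \<noteq> 1" "s \<noteq> -1"
    using assms by (auto simp: ts)
  \<comment> \<open>The ordinate of 2P, factored so that its valuation is visible when v2(s) is
    positive.\<close>
  define w where "w = s * (- 1 + (s ^ 2 + - s))"
  have P2: "ec_add A ?P ?P = pt (s ^ 2) w"
  proof -
    have "(1 - s) ^ 2 + t - 2 * 1 = s ^ 2" "(1 - s) * (1 - s ^ 2) - 1 = w"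
      unfolding ts w_def by algebra+
    then show ?thesis
      using pt_double [of 1 "1 - s" 1] by (simp add: ts)
  qed
  have on2: "pt (s ^ 2) w \<in> carrier (ec_group A B)"
    using on_curve_ec_add [of A B ?P ?P] unfolding P2 by simp
  then have w2: "w ^ 2 = (s ^ 2) ^ 3 - t * (s ^ 2) ^ 2 + t * s ^ 2"
    by simp
  have tors2: "torsion (pt (s ^ 2) w)"
    using torsion_nat_pow [OF tors, of 2] by (simp add: pow2 P2)
  consider "v2 s < 0" | "v2 s > 0" | "v2 s = 0"
    by linarith
  then show False
  proof cases
    case 1
    \<comment> \<open>This weak bound also covers v2(s) = -1, where 2 s and 1 are both units. It
      exceeds 2 v2(s), so 2P is already near infinity.\<close>
    have "v2 s + 1 \<le> v2 t"
      unfolding ts using s t 1 by (intro v2_add_ge) (auto simp: v2_mult ts)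
    then have "near_infinity (s ^ 2)"
      using s 1 by (simp add: near_infinity_def v2_power)
    then show False
      using near_infinity_not_torsion w2 tors2 by blast
  next
    case 2
    have vt: "v2 t = 0"
      unfolding ts using v2_add_dominant [of 1 "2 * s"] 2 s by (simp add: v2_mult add.commute)
    \<comment> \<open>Both this cofactor of \<open>w\<close> and the numerator \<open>N\<close>
      below are -1 plus terms of positive valuation, hence units. The abscissa of 4P thus has
      valuation -2 (1 + v2(s)).\<close>
    have "- 1 + (s ^ 2 + - s) \<noteq> 0" "v2 (- 1 + (s ^ 2 + - s)) = 0"
    proof -
      have "s ^ 2 + - s = 0 \<or> 1 \<le> v2 (s ^ 2 + - s)"
        using s 2 by (intro v2_add_ge') (simp_all add: v2_power)
      then show "- 1 + (s ^ 2 + - s) \<noteq> 0" "v2 (- 1 + (s ^ 2 + - s)) = 0"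
        using v2_add_dominant [of "- 1" "s ^ 2 + - s"] by auto
    qed
    then have "w \<noteq> 0" "v2 w = v2 s"
      using s v2_mult [of s "- 1 + (s ^ 2 + - s)"] unfolding w_def by (metis mult_eq_0_iff, linarith)
    moreover have "- 1 + (s ^ 4 + - (2 * s)) \<noteq> 0" "v2 (- 1 + (s ^ 4 + - (2 * s))) = 0"
    proof -
      have "s ^ 4 + - (2 * s) = 0 \<or> 1 \<le> v2 (s ^ 4 + - (2 * s))"
        using s 2 by (intro v2_add_ge') (simp_all add: v2_power v2_mult)
      then show "- 1 + (s ^ 4 + - (2 * s)) \<noteq> 0" "v2 (- 1 + (s ^ 4 + - (2 * s))) = 0"
        using v2_add_dominant [of "- 1" "s ^ 4 + - (2 * s)"] by auto
    qed
    moreover define N where "N = (s ^ 2) ^ 2 - t"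
    moreover have "N = - 1 + (s ^ 4 + - (2 * s))"
      unfolding N_def ts by algebra
    ultimately have "N \<noteq> 0" "v2 N = 0" "w \<noteq> 0" "v2 w = v2 s"
      by metis+
    then have "near_infinity ((N / (2 * w)) ^ 2)"
      using 2 vt by (simp add: near_infinity_def v2_power v2_quotient v2_mult)
    moreover obtain v where v: "ec_add A (pt (s ^ 2) w) (pt (s ^ 2) w) = pt ((N / (2 * w)) ^ 2) v"
      using pt_double_x [OF \<open>w \<noteq> 0\<close> w2] unfolding N_def by blast
    moreover have "torsion (pt ((N / (2 * w)) ^ 2) v)"
      using torsion_nat_pow [OF tors2, of 2] on2 by (simp only: pow2 v)
    ultimately show False
      using near_infinity_not_torsion by (metis torsion_def on_curve_pt ec_group_simps(1) mem_Collect_eq)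
  next
    case 3
    have vt: "v2 t = 0"
      unfolding ts using v2_add_dominant [of 1 "2 * s"] 3 s by (simp add: v2_mult add.commute)
    have f: "s + 1 \<noteq> 0" "s + - 1 \<noteq> 0"
      using s by auto
    have "1 \<le> v2 (s + 1)" "1 \<le> v2 (s + - 1)"
      using v2_units_add [of s 1] v2_units_add [of s "- 1"] f s 3 by simp_all
    then have v: "2 \<le> v2 ((s + 1) * (s + - 1))"
      using f by (simp add: v2_mult)
    define d where "d = (s + 1) * (s + - 1)"
    have d: "d \<noteq> 0" "2 \<le> v2 d"
      using v f by (simp_all add: d_def)
    \<comment> \<open>The chord from 2P to P has slope (1 - w) / (1 - s^2). Polynomial division
      turns it into (s - 1) - 2 / (s^2 - 1), and \<open>r\<close> is the fractional part: v2(s^2 -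
      1) is at least 2, so \<open>r\<close> has negative valuation and dominates.\<close>
    define r where "r = - (2 / d)"
    have r: "r \<noteq> 0" "v2 r < 0"
      using d by (simp_all add: r_def v2_quotient)
    define m where "m = r + (s + - 1)"
    have m: "m \<noteq> 0" "v2 m < 0"
      using v2_add_dominant [of r "s + - 1"] r \<open>1 \<le> v2 (s + - 1)\<close> unfolding m_def by auto
    have "t + - (1 + s ^ 2) = 0 \<or> 0 \<le> v2 (t + - (1 + s ^ 2))"
    proof -
      have "1 + s ^ 2 = 0 \<or> 0 \<le> v2 (1 + s ^ 2)"
        using s 3 by (intro v2_add_ge') (simp_all add: v2_power)
      then have "- (1 + s ^ 2) = 0 \<or> 0 \<le> v2 (- (1 + s ^ 2))"
        by (simp only: v2_simps neg_equal_0_iff_equal)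
      then show ?thesis
        using vt by (intro v2_add_ge') simp_all
    qed
    then have "m ^ 2 + (t + - (1 + s ^ 2)) \<noteq> 0" "v2 (m ^ 2 + (t + - (1 + s ^ 2))) = 2 * v2 m"
      using v2_add_dominant [of "m ^ 2" "t + - (1 + s ^ 2)"] m by (auto simp: v2_power)
    moreover have e: "m ^ 2 + (t + - (1 + s ^ 2)) = m ^ 2 + t - s ^ 2 - 1"
      by simp
    ultimately have "m ^ 2 + t - s ^ 2 - 1 \<noteq> 0" "v2 (m ^ 2 + t - s ^ 2 - 1) = 2 * v2 m"
      by metis+
    then have nz: "near_infinity (m ^ 2 + t - s ^ 2 - 1)"
      using m vt unfolding near_infinity_def by simp
    have "r * d = - 2"
      using d by (simp add: r_def)
    then have "m * (1 - s ^ 2) = 1 - w"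
      unfolding m_def w_def d_def by algebra
    moreover have "s ^ 2 \<noteq> 1"
      using s by (simp add: power2_eq_1_iff)
    ultimately obtain v' where v': "ec_add A (pt (s ^ 2) w) ?P = pt (m ^ 2 + t - s ^ 2 - 1) v'"
      using pt_chord [of "s ^ 2" 1 m 1 w] by blast
    have "?P [^]\<^bsub>ec_group A B\<^esub> (3::nat) = pt (m ^ 2 + t - s ^ 2 - 1) v'"
      using on by (simp add: numeral_3_eq_3 P2 v')
    then have "torsion (pt (m ^ 2 + t - s ^ 2 - 1) v')"
      using torsion_nat_pow [OF tors, of 3] by simp
    then show False
      using near_infinity_not_torsion nz by (metis torsion_def on_curve_pt ec_group_simps(1) mem_Collect_eq)
  qed
qed

end

theorem theorem2p2:
  fixes a b c :: rat
  assumes "a * b * c \<noteq> 0"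
    and "4 * a * c - b ^ 2 \<noteq> 0"
  shows "((\<forall>k \<in> {-1, 1, 3}. b ^ 2 \<noteq> k * a * c) \<longrightarrow> group_rank (E1_points a b c) > 0) \<and>
         ((\<exists>k \<in> {-1, 1, 3}. b ^ 2 = k * a * c) \<longrightarrow> group_rank (E1_points a b c) = 0)"
proof -
  define t where "t = b ^ 2 / (a * c)"
  have nz: "a \<noteq> 0" "b \<noteq> 0" "c \<noteq> 0"
    using assms by auto
  then have tb: "b ^ 2 = t * (a * c)"
    by (simp add: t_def)
  then have t: "t \<noteq> 0" "t \<noteq> 4"
    using nz assms(2) by (auto simp: mult.assoc)
  interpret E1_model "a * c" t
    using nz t by unfold_locales auto
  have "A = E1_A a b c" "B = E1_B a b c"
    unfolding A_def B_def E1_A_def E1_B_def using tb by algebra+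
  note AB = this [symmetric]
  have iff: "b ^ 2 = k * a * c \<longleftrightarrow> t = k" for k
    using tb nz by (simp add: mult.assoc)
  show ?thesis
    unfolding AB iff
  proof (intro conjI impI)
    assume "\<forall>k\<in>{-1, 1, 3}. t \<noteq> k"
    then have "\<not> torsion (pt 1 1)"
      by (intro base_point_not_torsion) auto
    then show "group_rank (ec_group A B) > 0"
      by (intro group_rank_pos [of "pt 1 1"]) simp_all
  next
    assume "\<exists>k\<in>{-1, 1, 3}. t = k"
    then have "\<exists>T. t = of_int T \<and> T \<in> {-1, 1, 3}"
      by (auto intro: exI [of _ "-1"] exI [of _ 1] exI [of _ 3])
    then show "group_rank (ec_group A B) = 0"
      using torsion_all group_rank_zero by metis
  qed
qed

end
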